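(* Let $G$ be a totally disconnected, locally compact group and let $H$ be an almost flat subgroup of $G$. Then the normalizer $\mathrm{N}_G(G^\dagger_H)$ is open in $G$.
   Context: Topological groups are Hausdorff. For $g \in G$, $\mathrm{con}(g) = \{x \in G \mid g^n x g^{-n} \to 1 \text{ as } n \to +\infty\}$. The relative Tits core is the abstract subgroup $G^\dagger_H := \langle \overline{\mathrm{con}(h)} \mid h \in H\rangle$. Tidy subgroups: for an automorphism $\alpha$ of $G$ (for $g\in G$, take $\alpha(x)=gxg^{-1}$) and a compact open subgroup $U$, put $U_+ = \bigcap_{n\ge 0}\alpha^n(U)$, $U_-=\bigcap_{n\le 0}\alpha^n(U)$, $U_{++} = \{g \in G \mid \exists m\in\mathbb{Z}\ \forall n \le m:\ \alpha^n(g)\in U\}$. $U$ is tidy for $\alpha$ if $U=U_+U_-$ and $U_{++}$ is closed; equivalently, $|\alpha(U):\alpha(U)\cap U|$ is minimal among all compact open subgroups. A subgroup $K$ of $G$ is flat on $G$ if there is a compact open subgroup $U$ of $G$ that is tidy for every element of $K$. A subgroup $H \le G$ is almost flat if $\overline{H}$ has a closed cocompact subgroup $K$ (i.e. $\overline{H}/K$ compact) that is flat on $G$. *)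

theory Defs
  imports
    "HOL-Analysis.Analysis"
    "HOL-Algebra.Bij"
    "HOL-Algebra.Generated_Groups"
    "HOL-Algebra.Group_Action"
begin

definition totally_disconnected_space :: "'a topology \<Rightarrow> bool" where
  "totally_disconnected_space X \<longleftrightarrow> (\<forall>C \<in> connected_components_of X. \<exists>x. C = {x})"

definition quotient_topology :: "'a topology \<Rightarrow> ('a \<Rightarrow> 'b) \<Rightarrow> 'b topology" where
  "quotient_topology X f =
     topology (\<lambda>V. V \<subseteq> f ` topspace X \<and> openin X {x \<in> topspace X. f x \<in> V})"

lemma openin_quotient_topology:
  "openin (quotient_topology X f) V \<longleftrightarrow>
     V \<subseteq> f ` topspace X \<and> openin X {x \<in> topspace X. f x \<in> V}"
proof -
  have "istopology (\<lambda>V. V \<subseteq> f ` topspace X \<and> openin X {x \<in> topspace X. f x \<in> V})"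
    unfolding istopology_def
  proof (intro conjI allI impI)
    fix S T
    assume S: "S \<subseteq> f ` topspace X \<and> openin X {x \<in> topspace X. f x \<in> S}"
      and T: "T \<subseteq> f ` topspace X \<and> openin X {x \<in> topspace X. f x \<in> T}"
    show "S \<inter> T \<subseteq> f ` topspace X" using S by blast
    have "{x \<in> topspace X. f x \<in> S \<inter> T} =
        {x \<in> topspace X. f x \<in> S} \<inter> {x \<in> topspace X. f x \<in> T}" by blast
    then show "openin X {x \<in> topspace X. f x \<in> S \<inter> T}" using S T by auto
  next
    fix \<K>
    assume K: "\<forall>K\<in>\<K>. K \<subseteq> f ` topspace X \<and> openin X {x \<in> topspace X. f x \<in> K}"
    then show "\<Union>\<K> \<subseteq> f ` topspace X" by blast
    have "{x \<in> topspace X. f x \<in> \<Union>\<K>} = (\<Union>K\<in>\<K>. {x \<in> topspace X. f x \<in> K})" by blast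
    then show "openin X {x \<in> topspace X. f x \<in> \<Union>\<K>}" using K by auto
  qed
  then show ?thesis by (simp add: quotient_topology_def)
qed

lemma topspace_quotient_topology: "topspace (quotient_topology X f) = f ` topspace X"
proof
  show "topspace (quotient_topology X f) \<subseteq> f ` topspace X"
    using openin_quotient_topology openin_topspace by metis
  have "{x \<in> topspace X. f x \<in> f ` topspace X} = topspace X" by blast
  then have "openin (quotient_topology X f) (f ` topspace X)"
    by (simp add: openin_quotient_topology)
  then show "f ` topspace X \<subseteq> topspace (quotient_topology X f)"
    by (rule openin_subset)
qed

lemma quotient_map_quotient_topology: "quotient_map X (quotient_topology X f) f"
  by (simp add: quotient_map_def openin_quotient_topology topspace_quotient_topology)

text \<open>Topological groups are Hausdorff by convention.\<close>

locale topological_group = group G for G (structure) +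
  fixes T :: "'a topology"
  assumes topspace_eq_carrier: "topspace T = carrier G"
    and continuous_mult: "continuous_map (prod_topology T T) T (\<lambda>(x, y). x \<otimes> y)"
    and continuous_inv: "continuous_map T T (\<lambda>x. inv x)"
    and Hausdorff: "Hausdorff_space T"

locale tdlc_group = topological_group +
  assumes totally_disconnected: "totally_disconnected_space T"
    and locally_compact: "locally_compact_space T"

definition compact_open_subgroup ::
    "('a, 'b) monoid_scheme \<Rightarrow> 'a topology \<Rightarrow> 'a set \<Rightarrow> bool" where
  "compact_open_subgroup G T U \<longleftrightarrow> subgroup U G \<and> compactin T U \<and> openin T U"

definition con :: "('a, 'b) monoid_scheme \<Rightarrow> 'a topology \<Rightarrow> 'a \<Rightarrow> 'a set" where
  "con G T g =
     {x \<in> carrier G.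
        limitin T (\<lambda>n::nat. g [^]\<^bsub>G\<^esub> n \<otimes>\<^bsub>G\<^esub> x \<otimes>\<^bsub>G\<^esub> inv\<^bsub>G\<^esub> (g [^]\<^bsub>G\<^esub> n)) \<one>\<^bsub>G\<^esub> sequentially}"

definition relative_Tits_core ::
    "('a, 'b) monoid_scheme \<Rightarrow> 'a topology \<Rightarrow> 'a set \<Rightarrow> 'a set" where
  "relative_Tits_core G T H = generate G (\<Union>h\<in>H. T closure_of (con G T h))"

text \<open>
  Automorphisms are elements of \<^term>\<open>AutoGroup G\<close>, hence extensional on the carrier, and
  their integer powers are taken in that group.
\<close>

definition inner_aut :: "('a, 'b) monoid_scheme \<Rightarrow> 'a \<Rightarrow> 'a \<Rightarrow> 'a" where
  "inner_aut G g = (\<lambda>x\<in>carrier G. g \<otimes>\<^bsub>G\<^esub> x \<otimes>\<^bsub>G\<^esub> inv\<^bsub>G\<^esub> g)"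

definition U_plus :: "('a, 'b) monoid_scheme \<Rightarrow> ('a \<Rightarrow> 'a) \<Rightarrow> 'a set \<Rightarrow> 'a set" where
  "U_plus G \<alpha> U = (\<Inter>n\<in>{0::int..}. (\<alpha> [^]\<^bsub>AutoGroup G\<^esub> n) ` U)"

definition U_minus :: "('a, 'b) monoid_scheme \<Rightarrow> ('a \<Rightarrow> 'a) \<Rightarrow> 'a set \<Rightarrow> 'a set" where
  "U_minus G \<alpha> U = (\<Inter>n\<in>{..0::int}. (\<alpha> [^]\<^bsub>AutoGroup G\<^esub> n) ` U)"

definition U_plusplus :: "('a, 'b) monoid_scheme \<Rightarrow> ('a \<Rightarrow> 'a) \<Rightarrow> 'a set \<Rightarrow> 'a set" where
  "U_plusplus G \<alpha> U =
     {x \<in> carrier G. \<exists>m::int. \<forall>n\<le>m. (\<alpha> [^]\<^bsub>AutoGroup G\<^esub> n) x \<in> U}"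

definition tidy ::
    "('a, 'b) monoid_scheme \<Rightarrow> 'a topology \<Rightarrow> ('a \<Rightarrow> 'a) \<Rightarrow> 'a set \<Rightarrow> bool" where
  "tidy G T \<alpha> U \<longleftrightarrow>
     compact_open_subgroup G T U \<and>
     U = U_plus G \<alpha> U <#>\<^bsub>G\<^esub> U_minus G \<alpha> U \<and>
     closedin T (U_plusplus G \<alpha> U)"

lemma (in group) inner_aut_in_auto:
  assumes "g \<in> carrier G"
  shows "inner_aut G g \<in> auto G"
proof -
  have c: "inner_aut G g x \<in> carrier G" if "x \<in> carrier G" for x
    using assms that by (simp add: inner_aut_def)
  have canc: "h \<otimes> (k \<otimes> x \<otimes> inv k) \<otimes> inv h = x"
    if "x \<in> carrier G" "h \<in> carrier G" "k \<in> carrier G" "h \<otimes> k = \<one>" for x h k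
  proof -
    have "h \<otimes> (k \<otimes> x \<otimes> inv k) \<otimes> inv h = (h \<otimes> k) \<otimes> x \<otimes> inv (h \<otimes> k)"
      using that(1-3) by (simp add: m_assoc inv_mult_group)
    then show ?thesis using that by simp
  qed
  have "inner_aut G g \<in> hom G G"
  proof (rule homI)
    fix x y assume xy: "x \<in> carrier G" "y \<in> carrier G"
    have "inv g \<otimes> (g \<otimes> (y \<otimes> inv g)) = y \<otimes> inv g"
      using assms xy by (simp flip: m_assoc)
    then have "g \<otimes> (x \<otimes> y) \<otimes> inv g = g \<otimes> x \<otimes> inv g \<otimes> (g \<otimes> y \<otimes> inv g)"
      using assms xy by (simp add: m_assoc)
    then show "inner_aut G g (x \<otimes> y) = inner_aut G g x \<otimes> inner_aut G g y"
      using xy by (simp add: inner_aut_def)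
  qed (use c in auto)
  moreover have "bij_betw (inner_aut G g) (carrier G) (carrier G)"
    using assms canc[of _ "inv g" g] canc[of _ g "inv g"]
    by (intro bij_betw_byWitness[where f' = "inner_aut G (inv g)"])
      (auto simp: inner_aut_def)
  ultimately show ?thesis
    by (simp add: auto_def Bij_def inner_aut_def)
qed

lemma (in group) inner_aut_mult:
  assumes "g \<in> carrier G" "h \<in> carrier G"
  shows "inner_aut G (g \<otimes> h) = inner_aut G g \<otimes>\<^bsub>AutoGroup G\<^esub> inner_aut G h"
proof -
  have "inner_aut G g \<in> Bij (carrier G)" "inner_aut G h \<in> Bij (carrier G)"
    using inner_aut_in_auto assms by (auto simp: auto_def)
  then show ?thesis
    using assms
    by (auto simp: AutoGroup_def BijGroup_def compose_def inner_aut_def fun_eq_iff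
        m_assoc inv_mult_group)
qed

lemma (in group) inner_aut_int_pow:
  assumes "g \<in> carrier G"
  shows "inner_aut G g [^]\<^bsub>AutoGroup G\<^esub> (n::int) = inner_aut G (g [^] n)"
proof -
  have "inner_aut G \<in> hom G (AutoGroup G)"
    by (rule homI) (simp_all add: inner_aut_in_auto inner_aut_mult AutoGroup_def[of G])
  then have "group_hom G (AutoGroup G) (inner_aut G)"
    by (intro group_hom.intro group_hom_axioms.intro) (simp_all add: AutoGroup group_axioms)
  then show ?thesis
    using assms by (simp add: group_hom.hom_int_pow)
qed

definition flat_subgroup ::
    "('a, 'b) monoid_scheme \<Rightarrow> 'a topology \<Rightarrow> 'a set \<Rightarrow> bool" where
  "flat_subgroup G T K \<longleftrightarrow>
     subgroup K G \<and>
     (\<exists>U. compact_open_subgroup G T U \<and> (\<forall>g\<in>K. tidy G T (inner_aut G g) U))"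

text \<open>The space of left cosets \<open>x K\<close> with \<open>x \<in> L\<close>, for subgroups \<open>K \<subseteq> L\<close> of \<open>G\<close>.\<close>

definition coset_space ::
    "('a, 'b) monoid_scheme \<Rightarrow> 'a topology \<Rightarrow> 'a set \<Rightarrow> 'a set \<Rightarrow> 'a set topology" where
  "coset_space G T L K = quotient_topology (subtopology T L) (\<lambda>x. x <#\<^bsub>G\<^esub> K)"

definition almost_flat ::
    "('a, 'b) monoid_scheme \<Rightarrow> 'a topology \<Rightarrow> 'a set \<Rightarrow> bool" where
  "almost_flat G T H \<longleftrightarrow>
     subgroup H G \<and>
     (\<exists>K. K \<subseteq> T closure_of H \<and>
          closedin T K \<and>
          compact_space (coset_space G T (T closure_of H) K) \<and>
          flat_subgroup G T K)"

end

theory Submission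
  imports Defs
begin

text \<open>
  Write \<open>\<alpha>\<close> for conjugation by \<open>g\<close> and \<open>core g\<close> for the group generated by the closures of
  \<open>con(g)\<close> and \<open>con(g\<inverse>)\<close>. Let \<open>U\<close> be a compact open subgroup with \<open>U = U\<^sub>-U\<^sub>+\<close>.

  Products of factors from \<open>U g\<close> can be shadowed: for \<open>u \<in> U\<close> there is one \<open>z \<in> U\<close> with
  \<open>(u g)\<^sup>n \<in> U g\<^sup>n z\<close> for all \<open>n \<ge> 0\<close>. Hence \<open>con(u g) \<subseteq> z\<inverse> con(g) z\<close>. The same shadowing,
  applied inside the compact \<open>\<alpha>\<close>-stable group \<open>U\<^sub>0 = U\<^sub>+ \<inter> U\<^sub>-\<close> and followed by a Zorn argument
  that replaces metrizability, gives \<open>U\<^sub>- \<subseteq> con(g) U\<^sub>0\<close>. As \<open>U\<^sub>0\<close> normalizes \<open>con(g)\<close> and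
  \<open>con(g\<inverse>)\<close>, all of \<open>U\<close> normalizes \<open>core g\<close>, and therefore \<open>core (u g) = core g\<close>.

  If \<open>U\<close> is tidy for the cocompact subgroup \<open>K\<close> of the closure \<open>L\<close> of \<open>H\<close>, then \<open>L\<close> is covered by
  finitely many sets \<open>x U K\<close> with \<open>x \<in> L\<close>. By pigeonhole every \<open>h \<in> H\<close> has a positive power
  conjugate to an element of \<open>U K\<close>, so the relative Tits core is generated by the finitely many
  families \<open>x (core k) x\<inverse>\<close>, and the open subgroup \<open>\<Inter> x U x\<inverse>\<close> normalizes each of them.
\<close>

text \<open>The finite intersection property for the sets \<open>D - S\<close> inside one compact
  \<open>D0\<close>: by directedness a single member lies below any finitely many. With
  \<open>S = {}\<close> it later yields common points of nested compact sets.\<close>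

lemma compact_directed_Inter_subset:
  assumes cpt: "\<And>D. D \<in> \<D> \<Longrightarrow> compactin X D" and clo: "\<And>D. D \<in> \<D> \<Longrightarrow> closedin X D"
    and ne: "\<D> \<noteq> {}"
    and dir: "\<And>A B. A \<in> \<D> \<Longrightarrow> B \<in> \<D> \<Longrightarrow> \<exists>C\<in>\<D>. C \<subseteq> A \<inter> B"
    and op: "openin X S" and sub: "\<Inter>\<D> \<subseteq> S"
  shows "\<exists>D\<in>\<D>. D \<subseteq> S"
proof (rule ccontr)
  assume neg: "\<not> (\<exists>D\<in>\<D>. D \<subseteq> S)"
  obtain D0 where D0: "D0 \<in> \<D>" using ne by blast
  have fin: "\<exists>C\<in>\<D>. C \<subseteq> D0 \<and> (\<forall>D\<in>F. C \<subseteq> D)" if "finite F" "F \<subseteq> \<D>" for F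
    using that
  proof (induction F rule: finite_induct)
    case empty
    then show ?case using D0 by blast
  next
    case (insert D F)
    then obtain C where C: "C \<in> \<D>" "C \<subseteq> D0" "\<forall>D\<in>F. C \<subseteq> D" by blast
    obtain E where E: "E \<in> \<D>" "E \<subseteq> C \<inter> D" using dir[OF C(1), of D] insert.prems by blast
    then have "E \<subseteq> D0 \<and> (\<forall>D'\<in>insert D F. E \<subseteq> D')" using C(2,3) by auto
    then show ?case using E(1) by blast
  qed
  let ?U = "(\<lambda>D. D - S) ` \<D>"
  have cl: "\<forall>C\<in>?U. closedin X C" using clo op by (auto intro: closedin_diff)
  have "D0 \<inter> \<Inter>\<F> \<noteq> {}" if F: "finite \<F>" "\<F> \<subseteq> ?U" for \<F>
  proof -
    obtain F where F': "F \<subseteq> \<D>" "finite F" "\<F> = (\<lambda>D. D - S) ` F"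
      using F finite_subset_image by metis
    obtain C where C: "C \<in> \<D>" "C \<subseteq> D0" "\<forall>D\<in>F. C \<subseteq> D" using fin[OF F'(2,1)] by blast
    then obtain x where "x \<in> C" "x \<notin> S" using neg by blast
    then have "x \<in> D0 \<inter> \<Inter>\<F>" using C F'(3) by auto
    then show ?thesis by blast
  qed
  then have "D0 \<inter> \<Inter>?U \<noteq> {}"
    using cpt[OF D0] cl unfolding compactin_fip by (metis (no_types, lifting))
  then obtain x where "x \<in> D0" "\<forall>D\<in>\<D>. x \<in> D - S" by blast
  then show False using sub D0 by blast
qed

section \<open>Conjugation\<close>

context group
begin

lemma inv_mult_cancel:
  assumes "x \<in> carrier G" "y \<in> carrier G"
  shows "inv x \<otimes> (x \<otimes> y) = y" "x \<otimes> (inv x \<otimes> y) = y"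
  using assms by (simp_all flip: m_assoc)

lemmas group_rewr = m_assoc inv_mult_group inv_mult_cancel

definition cj :: "'a \<Rightarrow> 'a \<Rightarrow> 'a" where
  "cj g x = g \<otimes> x \<otimes> inv g"

lemma cj_closed [simp, intro]: "g \<in> carrier G \<Longrightarrow> x \<in> carrier G \<Longrightarrow> cj g x \<in> carrier G"
  by (simp add: cj_def)

lemma cj_mult: "\<lbrakk>g \<in> carrier G; x \<in> carrier G; y \<in> carrier G\<rbrakk> \<Longrightarrow> cj g (x \<otimes> y) = cj g x \<otimes> cj g y"
  by (simp add: cj_def group_rewr)

lemma cj_inv: "\<lbrakk>g \<in> carrier G; x \<in> carrier G\<rbrakk> \<Longrightarrow> cj g (inv x) = inv (cj g x)"
  by (simp add: cj_def group_rewr)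

lemma cj_one [simp]: "g \<in> carrier G \<Longrightarrow> cj g \<one> = \<one>"
  by (simp add: cj_def)

lemma one_cj [simp]: "x \<in> carrier G \<Longrightarrow> cj \<one> x = x"
  by (simp add: cj_def)

lemma cj_cj: "\<lbrakk>g \<in> carrier G; h \<in> carrier G; x \<in> carrier G\<rbrakk> \<Longrightarrow> cj g (cj h x) = cj (g \<otimes> h) x"
  by (simp add: cj_def group_rewr)

lemma cj_cancel [simp]:
  assumes "g \<in> carrier G" "x \<in> carrier G"
  shows "cj g (cj (inv g) x) = x" "cj (inv g) (cj g x) = x"
  using assms by (simp_all add: cj_cj)

lemma cj_in_subgroup: "subgroup A G \<Longrightarrow> g \<in> A \<Longrightarrow> x \<in> A \<Longrightarrow> cj g x \<in> A"
  by (simp add: cj_def subgroup.m_closed subgroup.m_inv_closed)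

definition ad :: "'a \<Rightarrow> int \<Rightarrow> 'a \<Rightarrow> 'a" where
  "ad g i x = cj (g [^] i) x"

lemma ad_closed [simp, intro]: "g \<in> carrier G \<Longrightarrow> x \<in> carrier G \<Longrightarrow> ad g i x \<in> carrier G"
  by (simp add: ad_def)

lemma ad_mult: "\<lbrakk>g \<in> carrier G; x \<in> carrier G; y \<in> carrier G\<rbrakk> \<Longrightarrow> ad g i (x \<otimes> y) = ad g i x \<otimes> ad g i y"
  by (simp add: ad_def cj_mult)

lemma ad_inv: "\<lbrakk>g \<in> carrier G; x \<in> carrier G\<rbrakk> \<Longrightarrow> ad g i (inv x) = inv (ad g i x)"
  by (simp add: ad_def cj_inv)

lemma ad_one [simp]: "g \<in> carrier G \<Longrightarrow> ad g i \<one> = \<one>"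
  by (simp add: ad_def)

lemma ad_0 [simp]: "x \<in> carrier G \<Longrightarrow> ad g 0 x = x"
  by (simp add: ad_def)

lemma ad_ad: "\<lbrakk>g \<in> carrier G; x \<in> carrier G\<rbrakk> \<Longrightarrow> ad g i (ad g j x) = ad g (i + j) x"
  by (simp add: ad_def cj_cj int_pow_mult)

lemma ad_inv_left: "g \<in> carrier G \<Longrightarrow> ad (inv g) i x = ad g (- i) x"
  by (simp add: ad_def int_pow_inv int_pow_neg)

text \<open>With \<open>\<alpha>\<close> conjugation by \<open>g\<close>, \<open>U\<^sub>+\<close> is \<open>seg g U {..0}\<close> and \<open>U\<^sub>-\<close> is \<open>seg g U {0..}\<close>.\<close>

definition seg :: "'a \<Rightarrow> 'a set \<Rightarrow> int set \<Rightarrow> 'a set" where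
  "seg g A I = {x \<in> carrier G. \<forall>i\<in>I. ad g i x \<in> A}"

lemma seg_subset: "0 \<in> I \<Longrightarrow> seg g A I \<subseteq> A"
proof
  fix x assume "0 \<in> I" "x \<in> seg g A I"
  then have "ad g 0 x \<in> A" "x \<in> carrier G" by (auto simp: seg_def)
  then show "x \<in> A" by simp
qed

lemma subgroup_seg:
  assumes "subgroup A G" "g \<in> carrier G"
  shows "subgroup (seg g A I) G"
  using assms
  by (intro subgroupI)
    (auto simp: seg_def ad_mult ad_inv subgroup.m_closed subgroup.m_inv_closed subgroup.one_closed
      intro!: exI[of _ \<one>])

lemma seg_inv: "g \<in> carrier G \<Longrightarrow> seg (inv g) A I = seg g A (uminus ` I)"
  by (simp add: seg_def ad_inv_left)

lemma ad_in_seg: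
  assumes "g \<in> carrier G" "x \<in> carrier G"
  shows "ad g k x \<in> seg g A I \<longleftrightarrow> (\<forall>i\<in>I. ad g (i + k) x \<in> A)"
  using assms by (simp add: seg_def ad_ad)

text \<open>\<open>ad g i\<close> turns conjugation by \<open>c\<close> into conjugation by
  \<open>ad g i c\<close>, which is again an element of \<open>C\<close>.\<close>

lemma seg_normalized:
  assumes "g \<in> carrier G" "A \<subseteq> carrier G" "C \<subseteq> carrier G"
    and inv: "\<And>c i. c \<in> C \<Longrightarrow> ad g i c \<in> C"
    and norm: "\<And>c a. c \<in> C \<Longrightarrow> a \<in> A \<Longrightarrow> cj c a \<in> A"
    and "c \<in> C" "x \<in> seg g A I"
  shows "cj c x \<in> seg g A I"
proof -
  have c: "c \<in> carrier G" and x: "x \<in> carrier G" using assms by (auto simp: seg_def)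
  have "ad g i (cj c x) = cj (ad g i c) (ad g i x)" for i
    using assms(1) c x by (simp add: cj_def ad_mult ad_inv)
  then show ?thesis using assms c x by (auto simp: seg_def)
qed

end

section \<open>Continuity, and the topology of products and of the orbit windows
  \<open>seg\<close>\<close>

context topological_group
begin

lemma continuous_map_mult:
  assumes "continuous_map X T f" "continuous_map X T h"
  shows "continuous_map X T (\<lambda>x. f x \<otimes> h x)"
  using continuous_map_compose[OF continuous_map_pairedI[OF assms] continuous_mult]
  by (simp add: o_def)

lemma continuous_map_minv: "continuous_map X T f \<Longrightarrow> continuous_map X T (\<lambda>x. inv (f x))"
  using continuous_map_compose[OF _ continuous_inv] by (auto simp: o_def)

lemma continuous_map_constant: "c \<in> carrier G \<Longrightarrow> continuous_map X T (\<lambda>x. c)"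
  by (simp add: topspace_eq_carrier)

lemmas continuous_group_intros =
  continuous_map_mult continuous_map_minv continuous_map_constant
  continuous_map_fst continuous_map_snd continuous_map_id[unfolded id_def]

lemma continuous_cj: "g \<in> carrier G \<Longrightarrow> continuous_map T T (cj g)"
  unfolding cj_def[abs_def] by (intro continuous_group_intros) auto

lemma continuous_ad: "g \<in> carrier G \<Longrightarrow> continuous_map T T (ad g i)"
  unfolding ad_def[abs_def] using continuous_cj[of "g [^] i"] by (simp add: eta_contract_eq)

lemma openin_preimage:
  "continuous_map T T f \<Longrightarrow> openin T V \<Longrightarrow> openin T {x \<in> carrier G. f x \<in> V}"
  using openin_continuous_map_preimage[of T T f V] by (simp add: topspace_eq_carrier)

lemma closedin_preimage:
  "continuous_map T T f \<Longrightarrow> closedin T V \<Longrightarrow> closedin T {x \<in> carrier G. f x \<in> V}"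
  using closedin_continuous_map_preimage[of T T f V] by (simp add: topspace_eq_carrier)

lemma closedin_carrier: "closedin T (carrier G)"
  using closedin_topspace[of T] by (simp add: topspace_eq_carrier)

lemma openin_carrier: "openin T (carrier G)"
  using openin_topspace[of T] by (simp add: topspace_eq_carrier)

lemma closedin_preimages:
  assumes f: "\<And>i. i \<in> I \<Longrightarrow> continuous_map T T (f i)" and V: "closedin T V"
  shows "closedin T {x \<in> carrier G. \<forall>i\<in>I. f i x \<in> V}"
proof -
  have "{x \<in> carrier G. \<forall>i\<in>I. f i x \<in> V}
      = \<Inter>(insert (carrier G) ((\<lambda>i. {x \<in> carrier G. f i x \<in> V}) ` I))"
    by auto
  moreover have "closedin T \<dots>"
    using closedin_preimage[OF f V] closedin_carrier by (intro closedin_Inter) auto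
  ultimately show ?thesis by simp
qed

text \<open>The complement is the projection of a closed set along the compact factor \<open>C\<close>.\<close>

lemma openin_preimages_compact:
  assumes f: "continuous_map (prod_topology T T) T (\<lambda>(x, c). f x c)"
    and C: "compactin T C" and V: "openin T V"
  shows "openin T {x \<in> carrier G. \<forall>c\<in>C. f x c \<in> V}"
proof -
  let ?P = "prod_topology T (subtopology T C)"
  have sub: "C \<subseteq> carrier G" using C compactin_subset_topspace topspace_eq_carrier by blast
  have "continuous_map ?P T (\<lambda>(x, c). f x c)"
    using continuous_map_from_subtopology[OF f, of "topspace T \<times> C"]
    by (simp add: prod_topology_subtopology)
  from closedin_continuous_map_preimage[OF this, of "carrier G - V"]
  have "closedin ?P {p \<in> topspace ?P. (\<lambda>(x, c). f x c) p \<in> carrier G - V}"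
    using closedin_diff[OF closedin_carrier V] by simp
  moreover have "closed_map ?P T fst"
    using C by (intro closed_map_fst) (simp add: compact_space_subtopology)
  ultimately have "closedin T (fst ` {p \<in> topspace ?P. (\<lambda>(x, c). f x c) p \<in> carrier G - V})"
    by (simp add: closed_map_def)
  moreover have "{x \<in> carrier G. \<forall>c\<in>C. f x c \<in> V} =
      carrier G - fst ` {p \<in> topspace ?P. (\<lambda>(x, c). f x c) p \<in> carrier G - V}"
    (is "?l = carrier G - ?r")
  proof -
    have "f x c \<in> carrier G" if "x \<in> carrier G" "c \<in> C" for x c
      using continuous_map_image_subset_topspace[OF f] that sub by (force simp: topspace_eq_carrier)
    then have "?r = {x \<in> carrier G. \<exists>c\<in>C. f x c \<notin> V}"
      using sub by (force simp: topspace_eq_carrier image_iff)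
    then show ?thesis by auto
  qed
  ultimately show ?thesis using openin_diff[OF openin_carrier] by simp
qed

lemma compactin_closedin: "compactin T K \<Longrightarrow> closedin T K"
  using Hausdorff by (rule compactin_imp_closedin)

lemma openin_set_mult:
  assumes V: "openin T V" and C: "C \<subseteq> carrier G"
  shows "openin T (V <#> C)"
proof -
  have sub: "V \<subseteq> carrier G" using V openin_subset topspace_eq_carrier by blast
  have "V <#> C = (\<Union>c\<in>C. {x \<in> carrier G. x \<otimes> inv c \<in> V})"
  proof (intro equalityI subsetI)
    fix x assume "x \<in> V <#> C"
    then obtain v c where "v \<in> V" "c \<in> C" "x = v \<otimes> c" by (auto simp: set_mult_def)
    then show "x \<in> (\<Union>c\<in>C. {x \<in> carrier G. x \<otimes> inv c \<in> V})"
      using sub C by (auto simp: group_rewr subset_iff intro!: bexI[of _ c])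
  next
    fix x assume "x \<in> (\<Union>c\<in>C. {x \<in> carrier G. x \<otimes> inv c \<in> V})"
    then obtain c where c: "c \<in> C" "x \<in> carrier G" "x \<otimes> inv c \<in> V" by blast
    then have "x = (x \<otimes> inv c) \<otimes> c" using C by (auto simp: group_rewr subset_iff)
    then show "x \<in> V <#> C" using c by (auto simp: set_mult_def)
  qed
  moreover have "openin T {x \<in> carrier G. x \<otimes> inv c \<in> V}" if "c \<in> C" for c
    using that C by (intro openin_preimage[OF _ V] continuous_group_intros) auto
  ultimately show ?thesis by auto
qed

text \<open>Closed as an intersection of preimages, and inside the compact image of \<open>A\<close>
  under \<open>ad g (- i)\<close> for any \<open>i\<close> in \<open>I\<close>.\<close>

lemma compactin_seg:
  assumes A: "compactin T A" and g: "g \<in> carrier G" and I: "I \<noteq> {}"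
  shows "compactin T (seg g A I)"
proof -
  have sub: "A \<subseteq> carrier G" using A compactin_subset_topspace topspace_eq_carrier by blast
  obtain i where i: "i \<in> I" using I by blast
  have "seg g A I \<subseteq> ad g (- i) ` A"
  proof
    fix x assume x: "x \<in> seg g A I"
    then have "x = ad g (- i) (ad g i x)" using g by (auto simp: ad_ad seg_def)
    then show "x \<in> ad g (- i) ` A" using x i by (auto simp: seg_def)
  qed
  moreover have "compactin T (ad g (- i) ` A)"
    using image_compactin[OF A continuous_ad[OF g]] .
  moreover have "closedin T (seg g A I)"
    unfolding seg_def using continuous_ad[OF g] compactin_closedin[OF A] by (rule closedin_preimages)
  ultimately show ?thesis by (metis closed_compactin)
qed

lemma openin_seg:
  assumes A: "openin T A" and g: "g \<in> carrier G" and I: "finite I"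
  shows "openin T (seg g A I)"
proof -
  have "seg g A I = carrier G \<inter> \<Inter>((\<lambda>i. {x \<in> carrier G. ad g i x \<in> A}) ` I)"
    by (auto simp: seg_def)
  moreover have "openin T \<dots>"
  proof (cases "I = {}")
    case False
    then have "openin T (\<Inter>((\<lambda>i. {x \<in> carrier G. ad g i x \<in> A}) ` I))"
      using I openin_preimage[OF continuous_ad[OF g] A] by (intro openin_Inter) auto
    then show ?thesis using openin_carrier by (simp add: openin_Int)
  qed (simp add: openin_carrier)
  ultimately show ?thesis by simp
qed

end

section \<open>Compact open subgroups\<close>

abbreviation (in topological_group) co_subgroup :: "'a set \<Rightarrow> bool" where
  "co_subgroup V \<equiv> compact_open_subgroup G T V"

context tdlc_group
begin

lemma co_subgroupD: "co_subgroup V \<Longrightarrow> subgroup V G" "co_subgroup V \<Longrightarrow> compactin T V" "co_subgroup V \<Longrightarrow> openin T V"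
  by (simp_all add: compact_open_subgroup_def)

lemma co_subgroup_subset: "co_subgroup V \<Longrightarrow> V \<subseteq> carrier G"
  using co_subgroupD(1) subgroup.subset by blast

lemma co_subgroup_Int: "co_subgroup V \<Longrightarrow> co_subgroup W \<Longrightarrow> co_subgroup (V \<inter> W)"
  unfolding compact_open_subgroup_def
  by (metis Hausdorff compactin_Int openin_Int subgroups_Inter_pair)

lemma co_subgroup_seg: "co_subgroup V \<Longrightarrow> g \<in> carrier G \<Longrightarrow> finite I \<Longrightarrow> I \<noteq> {} \<Longrightarrow> co_subgroup (seg g V I)"
  unfolding compact_open_subgroup_def by (metis subgroup_seg compactin_seg openin_seg)

lemma co_subgroup_cj_vimage:
  assumes "co_subgroup V" "g \<in> carrier G"
  shows "co_subgroup {x \<in> carrier G. cj g x \<in> V}"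
proof -
  have "{x \<in> carrier G. cj g x \<in> V} = seg g V {1}"
    using assms by (simp add: seg_def ad_def)
  then show ?thesis using co_subgroup_seg[OF assms, of "{1}"] by simp
qed

lemma subset_co_subgroup_mult:
  assumes "co_subgroup V" "D \<subseteq> carrier G"
  shows "D \<subseteq> V <#> D"
proof
  fix x assume x: "x \<in> D"
  then have "x = \<one> \<otimes> x" using assms by auto
  then show "x \<in> V <#> D" using x subgroup.one_closed[OF co_subgroupD(1)[OF assms(1)]] unfolding set_mult_def by blast
qed

text \<open>In a compact neighbourhood \<open>N\<close> of \<open>\<one>\<close> components and
  quasi-components agree, so by total disconnectedness the clopen subsets of \<open>N\<close> around
  \<open>\<one>\<close> meet only in \<open>\<one>\<close>. Compactness puts one of them inside
  \<open>S\<close>.\<close>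

lemma clopen_nhd_one:
  assumes S: "openin T S" "\<one> \<in> S"
  shows "\<exists>K. compactin T K \<and> openin T K \<and> \<one> \<in> K \<and> K \<subseteq> S"
proof -
  obtain W N where W: "openin T W" "compactin T N" "\<one> \<in> W" "W \<subseteq> N"
    using locally_compact one_closed unfolding locally_compact_space_def topspace_eq_carrier by blast
  define X where "X = subtopology T N"
  have tX: "topspace X = N"
    unfolding X_def using W(2) by (intro topspace_subtopology_subset compactin_subset_topspace)
  have cX: "compact_space X" using W by (simp add: X_def compact_space_subtopology)
  moreover have HX: "Hausdorff_space X" by (simp add: X_def Hausdorff Hausdorff_space_subtopology)
  ultimately have "quasi_components_of X = connected_components_of X"
    by (simp add: quasi_eq_connected_components_of)
  then have q: "quasi_component_of_set X \<one> = connected_component_of_set X \<one>"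
    unfolding quasi_eq_connected_components_of_pointwise_alt by simp
  have "connected_component_of_set T \<one> \<in> connected_components_of T"
    by (simp add: connected_component_in_connected_components_of topspace_eq_carrier)
  then obtain a where a: "connected_component_of_set T \<one> = {a}"
    using totally_disconnected unfolding totally_disconnected_space_def by blast
  have "connected_component_of T \<one> \<one>"
    by (simp add: connected_component_of_refl topspace_eq_carrier)
  then have a1: "connected_component_of_set T \<one> = {\<one>}" using a by auto
  have "connected_component_of_set X \<one> \<subseteq> connected_component_of_set T \<one>"
    by (auto simp: X_def connected_component_of_def connectedin_subtopology)
  then have int: "\<Inter>{t. closedin X t \<and> openin X t \<and> \<one> \<in> t} \<subseteq> {\<one>}"
    using q a1 W tX by (simp add: quasi_component_of_set subset_eq split: if_splits)
  have "\<exists>D\<in>{t. closedin X t \<and> openin X t \<and> \<one> \<in> t}. D \<subseteq> N \<inter> (S \<inter> W)"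
  proof (rule compact_directed_Inter_subset[where X = X])
    show "compactin X D" if "D \<in> {t. closedin X t \<and> openin X t \<and> \<one> \<in> t}" for D
      using that cX closedin_compact_space by auto
    have "topspace X \<in> {t. closedin X t \<and> openin X t \<and> \<one> \<in> t}" using W tX by auto
    then show "{t. closedin X t \<and> openin X t \<and> \<one> \<in> t} \<noteq> {}" by blast
    show "\<exists>C\<in>{t. closedin X t \<and> openin X t \<and> \<one> \<in> t}. C \<subseteq> A \<inter> B"
      if "A \<in> {t. closedin X t \<and> openin X t \<and> \<one> \<in> t}" "B \<in> {t. closedin X t \<and> openin X t \<and> \<one> \<in> t}" for A B
      using that by (intro bexI[of _ "A \<inter> B"]) auto
    show "openin X (N \<inter> (S \<inter> W))"
      using S W by (auto simp: X_def openin_subtopology_Int2 openin_Int)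
    show "\<Inter>{t. closedin X t \<and> openin X t \<and> \<one> \<in> t} \<subseteq> N \<inter> (S \<inter> W)"
      using int S W by blast
  qed auto
  then obtain K where K: "closedin X K" "openin X K" "\<one> \<in> K" "K \<subseteq> N \<inter> (S \<inter> W)" by blast
  obtain R where R: "openin T R" "K = R \<inter> N" using K(2) by (auto simp: X_def openin_subtopology)
  \<comment> \<open>So far \<open>K\<close> is open only relative to \<open>N\<close>. Lying inside
    the open set \<open>W\<close>, which \<open>N\<close> contains, it is open in the group.\<close>
  have "K = R \<inter> W" using R K(4) W(4) by blast
  then have "openin T K" using R W by auto
  moreover have "compactin X K" using K cX closedin_compact_space by auto
  then have "compactin T K" by (simp add: X_def compactin_subtopology)
  ultimately show ?thesis using K by blast
qed

text \<open>\<open>V\<close> is the group of all \<open>x\<close> with \<open>x K = K\<close>,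
  formed as the invertible part of the monoid \<open>M\<close>. Compactness of \<open>K\<close>
  makes it open, and \<open>\<one>\<close> in \<open>K\<close> forces it into
  \<open>K\<close>.\<close>

lemma van_Dantzig:
  assumes S: "openin T S" "\<one> \<in> S"
  shows "\<exists>V. co_subgroup V \<and> V \<subseteq> S"
proof -
  obtain K where K: "compactin T K" "openin T K" "\<one> \<in> K" "K \<subseteq> S"
    using clopen_nhd_one[OF assms] by blast
  have sub: "K \<subseteq> carrier G" using K(2) openin_subset topspace_eq_carrier by blast
  define M where "M = {x \<in> carrier G. \<forall>k\<in>K. x \<otimes> k \<in> K}"
  define V where "V = M \<inter> {x \<in> carrier G. inv x \<in> M}"
  have oM: "openin T M"
    unfolding M_def using continuous_mult K by (intro openin_preimages_compact) auto
  have cM: "closedin T M"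
    unfolding M_def using sub K
    by (intro closedin_preimages compactin_closedin continuous_group_intros) auto
  have "openin T V"
    unfolding V_def using oM by (intro openin_Int openin_preimage continuous_group_intros)
  moreover have cV: "closedin T V"
    unfolding V_def using cM by (intro closedin_Int closedin_preimage continuous_group_intros)
  moreover have "V \<subseteq> K"
  proof
    fix x assume "x \<in> V"
    then have "x \<in> carrier G" "x \<otimes> \<one> \<in> K" using K(3) by (auto simp: V_def M_def)
    then show "x \<in> K" by simp
  qed
  moreover have "subgroup V G"
  proof (rule subgroupI)
    show "V \<subseteq> carrier G" by (auto simp: V_def)
    have "\<one> \<in> V" using sub by (auto simp: V_def M_def)
    then show "V \<noteq> {}" by blast
    show "inv x \<in> V" if "x \<in> V" for x using that by (auto simp: V_def)
    show "x \<otimes> y \<in> V" if "x \<in> V" "y \<in> V" for x y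
      using that sub by (auto simp: V_def M_def inv_mult_group m_assoc subset_iff)
  qed
  ultimately show ?thesis
    using K closed_compactin unfolding compact_open_subgroup_def by blast
qed

text \<open>\<open>W\<close> is the intersection of the conjugates \<open>c^-1 V c\<close>;
  compactness of \<open>C\<close> keeps it open. Closure of \<open>C\<close> under products gives
  the invariance, since \<open>cj d (cj c x) = cj (d \<otimes> c) x\<close>.\<close>

lemma co_subgroup_normal_core:
  assumes C: "compactin T C" "\<one> \<in> C" "\<And>c d. c \<in> C \<Longrightarrow> d \<in> C \<Longrightarrow> c \<otimes> d \<in> C" and V: "co_subgroup V"
  shows "\<exists>W. co_subgroup W \<and> W \<subseteq> V \<and> (\<forall>c\<in>C. \<forall>w\<in>W. cj c w \<in> W)"
proof -
  have sub: "C \<subseteq> carrier G" using C compactin_subset_topspace topspace_eq_carrier by blast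
  define W where "W = {x \<in> carrier G. \<forall>c\<in>C. cj c x \<in> V}"
  have WV: "W \<subseteq> V" using C(2) by (force simp: W_def)
  have "openin T W"
    unfolding W_def cj_def
    using C(1) co_subgroupD(3)[OF V]
    by (intro openin_preimages_compact)
      (auto simp: case_prod_unfold intro!: continuous_group_intros)
  moreover have "closedin T W"
    unfolding W_def using sub continuous_cj compactin_closedin co_subgroupD(2)[OF V]
    by (intro closedin_preimages) auto
  then have "compactin T W" using WV co_subgroupD(2)[OF V] closed_compactin by blast
  moreover have "subgroup W G"
    using co_subgroupD(1)[OF V] sub
    by (intro subgroupI)
      (auto simp: W_def cj_mult cj_inv subset_iff subgroup.m_closed subgroup.m_inv_closed
        subgroup.one_closed intro!: exI[of _ \<one>])
  moreover have "cj c w \<in> W" if "c \<in> C" "w \<in> W" for c w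
    using that C(3) sub by (auto simp: W_def cj_cj subset_iff)
  ultimately show ?thesis using WV unfolding compact_open_subgroup_def by blast
qed

end

section \<open>Shadowing and contraction groups\<close>

context group
begin

lemma pow_conj_nat:
  assumes "g \<in> carrier G" "u \<in> carrier G"
  shows "(g \<otimes> u) [^] (n::nat) = inv u \<otimes> (u \<otimes> g) [^] n \<otimes> u"
  using assms by (induction n) (simp_all add: group_rewr)

text \<open>The orbit of \<open>h\<close> follows \<open>g\<close> up to errors in \<open>A\<close>; the correction \<open>z\<close> absorbs the expanding part of
  each error, pulled back to time 0.\<close>

lemma shadow_finite:
  assumes A: "subgroup A G" and g: "g \<in> carrier G"
    and split: "\<And>a. a \<in> A \<Longrightarrow> \<exists>b\<in>A. \<exists>c\<in>seg g A {..0}. a = b \<otimes> c \<and> ad g 1 b \<in> A"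
    and u: "\<And>n::nat. u n \<in> A" and h: "h 0 = \<one>" "\<And>n. h (Suc n) = u n \<otimes> g \<otimes> h n"
  shows "\<exists>z\<in>A. \<forall>n\<le>N. h n \<otimes> inv z \<otimes> inv (g [^] int n) \<in> A"
proof (induction N)
  case 0
  then show ?case using subgroup.one_closed[OF A] by (intro bexI[of _ \<one>]) (auto simp: h)
next
  case (Suc N)
  have AG: "a \<in> carrier G" if "a \<in> A" for a using that subgroup.subset[OF A] by blast
  have uG': "u n \<in> carrier G" for n using u AG by blast
  have hG: "h n \<in> carrier G" for n by (induction n) (simp_all add: h uG' g)
  obtain z where z: "z \<in> A" "\<And>n. n \<le> N \<Longrightarrow> h n \<otimes> inv z \<otimes> inv (g [^] int n) \<in> A"
    using Suc by blast
  define p where "p = g [^] int N"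
  have p: "p \<in> carrier G" by (simp add: p_def g)
  \<comment> \<open>\<open>w\<close> is the error at time \<open>N\<close>. Its part
    \<open>c\<close> stays in \<open>A\<close> under backward powers, so it can be moved to time 0
    as \<open>c'\<close>; its part \<open>b\<close> survives one forward step.\<close>
  define w where "w = h N \<otimes> inv z \<otimes> inv p"
  have "w \<in> A" using z(2)[of N] by (simp add: w_def p_def)
  then obtain b c where bc: "b \<in> A" "c \<in> seg g A {..0}" "w = b \<otimes> c" "ad g 1 b \<in> A"
    using split by blast
  have cG: "c \<in> carrier G" using bc by (simp add: seg_def)
  have zG: "z \<in> carrier G" and bG: "b \<in> carrier G" and wG: "w \<in> carrier G" and uG: "u N \<in> carrier G"
    using AG z bc \<open>w \<in> A\<close> u by auto
  define c' where "c' = ad g (- int N) c"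
  have c'A: "c' \<in> A" using bc by (simp add: c'_def seg_def)
  then have c'G: "c' \<in> carrier G" by (rule AG)
  have hN: "h N = w \<otimes> p \<otimes> z" using hG zG p by (simp add: w_def group_rewr)
  have c'p: "c' = inv p \<otimes> c \<otimes> p"
    using g cG by (simp add: c'_def ad_def cj_def p_def int_pow_neg)
  show ?case
  proof (intro bexI[of _ "c' \<otimes> z"] allI impI)
    show "c' \<otimes> z \<in> A" using subgroup.m_closed[OF A c'A z(1)] .
    fix n assume "n \<le> Suc N"
    then consider "n \<le> N" | "n = Suc N" by linarith
    then show "h n \<otimes> inv (c' \<otimes> z) \<otimes> inv (g [^] int n) \<in> A"
    proof cases
      case 1
      \<comment> \<open>At earlier times the error is multiplied by the inverse of
        \<open>ad g (n - N) c\<close>, whose exponent is at most 0.\<close>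
      have "h n \<otimes> inv (c' \<otimes> z) \<otimes> inv (g [^] int n)
          = (h n \<otimes> inv z \<otimes> inv (g [^] int n)) \<otimes> inv (ad g (int n) c')"
        using hG zG c'G g by (simp add: ad_def cj_def group_rewr)
      also have "ad g (int n) c' = ad g (int n - int N) c"
        using g cG by (simp add: c'_def ad_ad)
      finally show ?thesis
        using z(2)[OF 1] bc(2) 1 subgroup.m_closed[OF A] subgroup.m_inv_closed[OF A]
        by (simp add: seg_def)
    next
      case 2
      have "g [^] int (Suc N) = g \<otimes> p"
        using g int_pow_mult[of g 1 "int N"] by (simp add: p_def)
      \<comment> \<open>At the new time the factor \<open>c\<close> of \<open>w\<close> cancels,
        leaving only \<open>b\<close> moved one step forward.\<close>
      then have "h n \<otimes> inv (c' \<otimes> z) \<otimes> inv (g [^] int n) = u N \<otimes> ad g 1 b"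
        using 2 h(2) hN bc(3) zG p c'G uG g bG cG by (simp add: c'p ad_def cj_def group_rewr)
      then show ?thesis using u bc subgroup.m_closed[OF A] by simp
    qed
  qed
qed

text \<open>This is \<open>U = U\<^sub>-U\<^sub>+\<close>; for a subgroup \<open>U\<close>, inversion turns it into \<open>U = U\<^sub>+U\<^sub>-\<close>.\<close>

definition tidy_above :: "'a \<Rightarrow> 'a set \<Rightarrow> bool" where
  "tidy_above g U \<longleftrightarrow> (\<forall>x\<in>U. \<exists>a\<in>seg g U {0..}. \<exists>b\<in>seg g U {..0}. x = a \<otimes> b)"

text \<open>Inverting an element swaps the order of its two factors, and passing to
  \<open>inv g\<close> swaps the two half-lines; the two reversals cancel.\<close>

lemma tidy_above_inv:
  assumes "subgroup U G" "g \<in> carrier G" "tidy_above g U"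
  shows "tidy_above (inv g) U"
  unfolding tidy_above_def
proof
  fix x assume x: "x \<in> U"
  then have "inv x \<in> U" by (rule subgroup.m_inv_closed[OF assms(1)])
  then obtain a b where ab: "a \<in> seg g U {0..}" "b \<in> seg g U {..0}" "inv x = a \<otimes> b"
    using assms(3) unfolding tidy_above_def by blast
  have "x \<in> carrier G" "a \<in> carrier G" "b \<in> carrier G"
    using x ab subgroup.subset[OF assms(1)] by (auto simp: seg_def)
  then have "x = inv b \<otimes> inv a" using ab(3) by (metis inv_inv inv_mult_group)
  moreover have "inv b \<in> seg (inv g) U {0..}" "inv a \<in> seg (inv g) U {..0}"
    using ab assms subgroup.m_inv_closed[OF subgroup_seg[OF assms(1,2)]] by (auto simp: seg_inv)
  ultimately show "\<exists>a\<in>seg (inv g) U {0..}. \<exists>b\<in>seg (inv g) U {..0}. x = a \<otimes> b" by blast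
qed

text \<open>Conjugation by the tracking error, an element of \<open>U\<close>, turns the forward
  \<open>g\<close>-orbit of \<open>cj z x\<close> into the forward \<open>h\<close>-orbit of
  \<open>x\<close>.\<close>

lemma track_seg:
  assumes U: "subgroup U G" and g: "g \<in> carrier G" and h: "h \<in> carrier G" and z: "z \<in> U"
    and track: "\<And>n::nat. h [^] int n \<otimes> inv z \<otimes> inv (g [^] int n) \<in> U"
    and x: "x \<in> carrier G" "cj z x \<in> seg g U {0..}"
  shows "x \<in> seg h U {0..}"
proof -
  have zG: "z \<in> carrier G" using z subgroup.subset[OF U] by blast
  have "ad h (int n) x \<in> U" for n
  proof -
    let ?w = "h [^] int n \<otimes> inv z \<otimes> inv (g [^] int n)"
    have "ad h (int n) x = cj ?w (ad g (int n) (cj z x))"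
      using g h zG x(1) by (simp add: ad_def cj_def group_rewr)
    then show ?thesis using track x(2) cj_in_subgroup[OF U] by (simp add: seg_def)
  qed
  then show ?thesis using x(1) by (auto simp: seg_def elim!: nonneg_int_cases)
qed

lemma generate_cj:
  assumes "u \<in> carrier G" "S \<subseteq> carrier G" "subgroup D G" "\<And>s. s \<in> S \<Longrightarrow> cj u s \<in> D"
    and "x \<in> generate G S"
  shows "cj u x \<in> D"
  using assms(5)
proof induction
  case one
  then show ?case using assms by (simp add: subgroup.one_closed)
next
  case (incl h)
  then show ?case using assms by simp
next
  case (inv h)
  then have "h \<in> carrier G" using assms by blast
  then show ?case using assms inv by (simp add: cj_inv subgroup.m_inv_closed)
next
  case (eng h1 h2)
  moreover have "h1 \<in> carrier G" "h2 \<in> carrier G"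
    using generate_incl[OF assms(2)] eng by blast+
  ultimately show ?case using assms by (simp add: cj_mult subgroup.m_closed)
qed

end

context tdlc_group
begin

text \<open>The passage from finitely many times to all times: the sets \<open>Z N\<close> of
  corrections valid up to time \<open>N\<close> are nonempty, closed and decreasing in the compact
  \<open>A\<close>.\<close>

lemma shadow:
  assumes A: "subgroup A G" and cA: "compactin T A" and g: "g \<in> carrier G"
    and split: "\<And>a. a \<in> A \<Longrightarrow> \<exists>b\<in>A. \<exists>c\<in>seg g A {..0}. a = b \<otimes> c \<and> ad g 1 b \<in> A"
    and u: "\<And>n::nat. u n \<in> A" and h: "h 0 = \<one>" "\<And>n. h (Suc n) = u n \<otimes> g \<otimes> h n"
  shows "\<exists>z\<in>A. \<forall>n. h n \<otimes> inv z \<otimes> inv (g [^] int n) \<in> A"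
proof -
  have AG: "A \<subseteq> carrier G" using subgroup.subset[OF A] .
  have uG: "u n \<in> carrier G" for n using u AG by blast
  have hG: "h n \<in> carrier G" for n by (induction n) (simp_all add: h uG g)
  define Z where "Z N = {z \<in> A. \<forall>n\<in>{..N}. h n \<otimes> inv z \<otimes> inv (g [^] int n) \<in> A}" for N
  have cl: "closedin T (Z N)" for N
  proof -
    have "Z N = A \<inter> {z \<in> carrier G. \<forall>n\<in>{..N}. h n \<otimes> inv z \<otimes> inv (g [^] int n) \<in> A}"
      using AG by (auto simp: Z_def)
    moreover have "closedin T {z \<in> carrier G. \<forall>n\<in>{..N}. h n \<otimes> inv z \<otimes> inv (g [^] int n) \<in> A}"
      using hG g compactin_closedin[OF cA]
      by (intro closedin_preimages continuous_group_intros) auto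
    ultimately show ?thesis by (simp only: closedin_Int[OF compactin_closedin[OF cA]])
  qed
  have "\<Inter>(range Z) \<noteq> {}"
  proof
    assume e: "\<Inter>(range Z) = {}"
    have "\<exists>D\<in>range Z. D \<subseteq> {}"
    proof (rule compact_directed_Inter_subset[where X = T])
      show "compactin T D" if "D \<in> range Z" for D
        using that cl closed_compactin[OF cA] by (auto simp: Z_def)
      show "\<exists>C\<in>range Z. C \<subseteq> P \<inter> Q" if PQ: "P \<in> range Z" "Q \<in> range Z" for P Q
      proof -
        obtain m n where "P = Z m" "Q = Z n" using PQ by blast
        then have "Z (max m n) \<subseteq> P \<inter> Q" by (auto simp: Z_def)
        then show ?thesis by blast
      qed
    qed (use cl e in auto)
    then obtain N where "Z N = {}" by blast
    moreover have "Z N \<noteq> {}"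
      using shadow_finite[OF A g split, of u h N] u h by (auto simp: Z_def)
    ultimately show False by blast
  qed
  then obtain z where "\<And>N. z \<in> Z N" by blast
  then show ?thesis by (auto simp: Z_def)
qed

text \<open>The instance of \<open>shadow\<close> with constant perturbation \<open>u\<close>. The
  factor from \<open>U_-\<close> serves as \<open>b\<close>, because its first forward step stays in
  \<open>U\<close>.\<close>

lemma tidy_above_track:
  assumes U: "subgroup U G" "compactin T U" and g: "g \<in> carrier G" and t: "tidy_above g U"
    and u: "u \<in> U"
  shows "\<exists>z\<in>U. \<forall>n::nat. (u \<otimes> g) [^] int n \<otimes> inv z \<otimes> inv (g [^] int n) \<in> U"
proof -
  have uG: "u \<in> carrier G" using u subgroup.subset[OF U(1)] by blast
  have split: "\<exists>b\<in>U. \<exists>c\<in>seg g U {..0}. a = b \<otimes> c \<and> ad g 1 b \<in> U" if aU: "a \<in> U" for a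
  proof -
    obtain b c where bc: "b \<in> seg g U {0..}" "c \<in> seg g U {..0}" "a = b \<otimes> c"
      using bspec[OF t[unfolded tidy_above_def] aU] by blast
    have "ad g i b \<in> U" if "i \<ge> 0" for i using bc(1) that by (simp add: seg_def)
    from this[of 0] this[of 1] have "b \<in> U" "ad g 1 b \<in> U" using bc(1) by (simp_all add: seg_def)
    then show ?thesis using bc by blast
  qed
  show ?thesis
  proof (rule shadow[where A = U and g = g and u = "\<lambda>n. u" and h = "\<lambda>n. (u \<otimes> g) [^] int n"])
    show "subgroup U G" "compactin T U" "g \<in> carrier G" "u \<in> U" by fact+
    show "(u \<otimes> g) [^] int 0 = \<one>" by simp
    show "\<exists>b\<in>U. \<exists>c\<in>seg g U {..0}. a = b \<otimes> c \<and> ad g 1 b \<in> U" if "a \<in> U" for a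
      using that by (rule split)
    show "(u \<otimes> g) [^] int (Suc n) = u \<otimes> g \<otimes> (u \<otimes> g) [^] int n" for n
      unfolding int_pow_int by (rule nat_pow_Suc2) (simp add: uG g)
  qed
qed

text \<open>Since \<open>g \<otimes> u\<close> is conjugate to \<open>u \<otimes> g\<close> by
  \<open>inv u\<close>, the correction \<open>z\<close> becomes \<open>z \<otimes> u\<close>.
  Perturbations on the right arise when \<open>u \<otimes> g\<close> is inverted.\<close>

lemma tidy_above_track_right:
  assumes U: "subgroup U G" "compactin T U" and g: "g \<in> carrier G" and t: "tidy_above g U"
    and u: "u \<in> U"
  shows "\<exists>z\<in>U. \<forall>n::nat. (g \<otimes> u) [^] int n \<otimes> inv z \<otimes> inv (g [^] int n) \<in> U"
proof -
  have uG: "u \<in> carrier G" using u subgroup.subset[OF U(1)] by blast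
  obtain z where z: "z \<in> U" "\<And>n::nat. (u \<otimes> g) [^] int n \<otimes> inv z \<otimes> inv (g [^] int n) \<in> U"
    using tidy_above_track[OF assms] by blast
  have zG: "z \<in> carrier G" using z subgroup.subset[OF U(1)] by blast
  have "(g \<otimes> u) [^] int n \<otimes> inv (z \<otimes> u) \<otimes> inv (g [^] int n) \<in> U" for n :: nat
  proof -
    have "(g \<otimes> u) [^] int n \<otimes> inv (z \<otimes> u) \<otimes> inv (g [^] int n)
        = inv u \<otimes> ((u \<otimes> g) [^] int n \<otimes> inv z \<otimes> inv (g [^] int n))"
      unfolding int_pow_int pow_conj_nat[OF g uG] using g uG zG by (simp add: group_rewr)
    then show ?thesis
      using subgroup.m_closed[OF U(1) subgroup.m_inv_closed[OF U(1) u] z(2)] by simp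
  qed
  then show ?thesis using subgroup.m_closed[OF U(1) z(1) u] by blast
qed

text \<open>Forward tracking by \<open>z\<close> and backward tracking by \<open>y\<close> carry the
  half-line groups of \<open>g\<close> into those of \<open>u \<otimes> g\<close> by conjugation.
  What remains is to match two different conjugators in one product.\<close>

lemma tidy_above_perturb:
  assumes U: "subgroup U G" "compactin T U" and g: "g \<in> carrier G" and t: "tidy_above g U"
    and u: "u \<in> U"
  shows "tidy_above (u \<otimes> g) U"
  unfolding tidy_above_def
proof
  have UG: "U \<subseteq> carrier G" using subgroup.subset[OF U(1)] .
  have uG: "u \<in> carrier G" using u UG by blast
  note t' = tidy_above_inv[OF U(1) g t]
  obtain z where z: "z \<in> U" "\<And>n::nat. (u \<otimes> g) [^] int n \<otimes> inv z \<otimes> inv (g [^] int n) \<in> U"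
    using tidy_above_track[OF assms] by blast
  obtain y where y: "y \<in> U"
    "\<And>n::nat. (inv g \<otimes> inv u) [^] int n \<otimes> inv y \<otimes> inv (inv g [^] int n) \<in> U"
    using tidy_above_track_right[OF U _ t' subgroup.m_inv_closed[OF U(1) u]] g by blast
  have split: "\<exists>p\<in>seg g U {0..}. \<exists>q\<in>seg g U {..0}. w = p \<otimes> q" if "w \<in> U" for w
    by (rule bspec[OF t[unfolded tidy_above_def] that])
  fix a assume a: "a \<in> U"
  \<comment> \<open>The aim is \<open>a = (z^-1 p z)(y^-1 q y)\<close>, that is
    \<open>p ?s q = ?t\<close> with \<open>p\<close> in \<open>U_-\<close> and \<open>q\<close> in
    \<open>U_+\<close>. Splitting both \<open>?s\<close> and \<open>?t\<close> solves this.\<close>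
  let ?s = "z \<otimes> inv y" and ?t = "z \<otimes> a \<otimes> inv y"
  have "?s \<in> U" "?t \<in> U" using a z y U(1) by (simp_all add: subgroup.m_closed subgroup.m_inv_closed)
  then obtain s1 s2 t1 t2 where
    st: "s1 \<in> seg g U {0..}" "s2 \<in> seg g U {..0}" "?s = s1 \<otimes> s2"
        "t1 \<in> seg g U {0..}" "t2 \<in> seg g U {..0}" "?t = t1 \<otimes> t2"
    using split by metis
  have G: "s1 \<in> carrier G" "s2 \<in> carrier G" "t1 \<in> carrier G" "t2 \<in> carrier G"
      "a \<in> carrier G" "z \<in> carrier G" "y \<in> carrier G"
    using st a z y UG by (auto simp: seg_def)
  define p where "p = t1 \<otimes> inv s1"
  define q where "q = inv s2 \<otimes> t2"
  have pq: "p \<in> seg g U {0..}" "q \<in> seg g U {..0}"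
    using st subgroup_seg[OF U(1) g] by (simp_all add: p_def q_def subgroup.m_closed subgroup.m_inv_closed)
  have pqG: "p \<in> carrier G" "q \<in> carrier G" using G by (simp_all add: p_def q_def)
  have "cj (inv z) p \<in> seg (u \<otimes> g) U {0..}"
    using track_seg[OF U(1) g _ z, of "cj (inv z) p"] uG g G pq pqG by simp
  moreover have "cj (inv y) q \<in> seg (inv g \<otimes> inv u) U {0..}"
    using track_seg[OF U(1) _ _ y, of "cj (inv y) q"] uG g G pq pqG by (simp add: seg_inv)
  then have "cj (inv y) q \<in> seg (u \<otimes> g) U {..0}"
    using uG g seg_inv[of "u \<otimes> g" U "{0..}"] by (simp add: inv_mult_group)
  moreover have "a = cj (inv z) p \<otimes> cj (inv y) q"
  proof -
    have "p \<otimes> ?s \<otimes> q = ?t" using G by (simp add: p_def q_def st(3,6) group_rewr)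
    then have "inv z \<otimes> (p \<otimes> ?s \<otimes> q) \<otimes> y = a" using G by (simp add: group_rewr)
    then show ?thesis using G pqG by (simp add: cj_def group_rewr)
  qed
  ultimately show "\<exists>a'\<in>seg (u \<otimes> g) U {0..}. \<exists>b\<in>seg (u \<otimes> g) U {..0}. a = a' \<otimes> b" by blast
qed

section \<open>Contraction groups under tracking and compact conjugation\<close>

lemma con_iff:
  assumes g: "g \<in> carrier G"
  shows "x \<in> con G T g \<longleftrightarrow>
    x \<in> carrier G \<and> (\<forall>V. co_subgroup V \<longrightarrow> (\<forall>\<^sub>F n in sequentially. ad g (int n) x \<in> V))"
proof -
  have eq: "g [^] n \<otimes> x \<otimes> inv (g [^] n) = ad g (int n) x" for n :: nat
    by (simp add: ad_def cj_def int_pow_int)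
  show ?thesis
    unfolding con_def mem_Collect_eq limitin_def eq topspace_eq_carrier
  proof safe
    fix V assume "\<forall>S. openin T S \<and> \<one> \<in> S \<longrightarrow> (\<forall>\<^sub>F n in sequentially. ad g (int n) x \<in> S)" "co_subgroup V"
    then show "\<forall>\<^sub>F n in sequentially. ad g (int n) x \<in> V"
      using co_subgroupD(3)[of V] subgroup.one_closed[OF co_subgroupD(1)] by blast
  next
    fix S assume V: "\<forall>V. co_subgroup V \<longrightarrow> (\<forall>\<^sub>F n in sequentially. ad g (int n) x \<in> V)" "openin T S" "\<one> \<in> S"
    \<comment> \<open>By van Dantzig's theorem compact open subgroups suffice as test neighbourhoods
      of \<open>\<one>\<close>.\<close>
    then obtain V' where V': "co_subgroup V'" "V' \<subseteq> S" using van_Dantzig by blast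
    then have "\<forall>\<^sub>F n in sequentially. ad g (int n) x \<in> V'" using V(1) by simp
    then show "\<forall>\<^sub>F n in sequentially. ad g (int n) x \<in> S"
      by (rule eventually_mono) (use V' in blast)
  qed simp
qed

lemma con_subset: "con G T g \<subseteq> carrier G"
  by (auto simp: con_def)

lemma closure_con_subset: "T closure_of con G T g \<subseteq> carrier G"
  using closure_of_subset_topspace topspace_eq_carrier by metis

text \<open>Conjugating each term of a sequence by some element of a compact group does not disturb
  convergence to \<open>\<one>\<close>, because the \<open>U\<close>-invariant compact open
  subgroups form a neighbourhood basis.\<close>

lemma con_conj_compact:
  assumes U: "subgroup U G" "compactin T U" and g: "g \<in> carrier G" and h: "h \<in> carrier G"
    and x: "x \<in> con G T h" and y: "y \<in> carrier G"
    and w: "\<And>n::nat. w n \<in> U" "\<And>n. ad g (int n) y = cj (w n) (ad h (int n) x)"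
  shows "y \<in> con G T g"
  unfolding con_iff[OF g]
proof (intro conjI allI impI)
  fix V assume "co_subgroup V"
  then obtain W where W: "co_subgroup W" "W \<subseteq> V" "\<forall>c\<in>U. \<forall>w\<in>W. cj c w \<in> W"
    using co_subgroup_normal_core[OF U(2) subgroup.one_closed[OF U(1)] subgroup.m_closed[OF U(1)]] by blast
  have "\<forall>\<^sub>F n in sequentially. ad h (int n) x \<in> W" using x W(1) by (simp add: con_iff[OF h])
  then show "\<forall>\<^sub>F n in sequentially. ad g (int n) y \<in> V"
    by eventually_elim (use w W in auto)
qed (rule y)

text \<open>The two forward orbits differ by conjugation with inverse tracking errors, all of which
  lie in \<open>U\<close>.\<close>

lemma con_track:
  assumes U: "subgroup U G" "compactin T U" and g: "g \<in> carrier G" and h: "h \<in> carrier G" and z: "z \<in> U"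
    and track: "\<And>n::nat. h [^] int n \<otimes> inv z \<otimes> inv (g [^] int n) \<in> U"
    and x: "x \<in> con G T h"
  shows "cj z x \<in> con G T g"
proof (rule con_conj_compact[OF U g h x])
  have zG: "z \<in> carrier G" using z subgroup.subset[OF U(1)] by blast
  have xG: "x \<in> carrier G" using x con_subset by blast
  show "cj z x \<in> carrier G" using zG xG by simp
  show "inv (h [^] int n \<otimes> inv z \<otimes> inv (g [^] int n)) \<in> U" for n :: nat
    using track subgroup.m_inv_closed[OF U(1)] by blast
  show "ad g (int n) (cj z x) = cj (inv (h [^] int n \<otimes> inv z \<otimes> inv (g [^] int n))) (ad h (int n) x)" for n :: nat
    using g h zG xG by (simp add: ad_def cj_def group_rewr)
qed

text \<open>The whole forward orbit of \<open>a\<close> stays in the compact group \<open>U\<close>,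
  so it can serve as the conjugating sequence.\<close>

lemma seg_normalizes_con:
  assumes U: "subgroup U G" "compactin T U" and g: "g \<in> carrier G"
    and a: "a \<in> seg g U {0..}" and x: "x \<in> con G T g"
  shows "cj a x \<in> con G T g"
proof (rule con_conj_compact[OF U g g x])
  have aG: "a \<in> carrier G" using a by (simp add: seg_def)
  have xG: "x \<in> carrier G" using x con_subset by blast
  show "cj a x \<in> carrier G" using aG xG by simp
  show "ad g (int n) a \<in> U" for n using a by (simp add: seg_def)
  show "ad g (int n) (cj a x) = cj (ad g (int n) a) (ad g (int n) x)" for n
    using g aG xG by (simp add: cj_def ad_mult ad_inv)
qed

lemma closure_cj:
  assumes a: "a \<in> carrier G" and sub: "\<And>x. x \<in> A \<Longrightarrow> cj a x \<in> B" and x: "x \<in> T closure_of A"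
  shows "cj a x \<in> T closure_of B"
proof -
  have "cj a ` (T closure_of A) \<subseteq> T closure_of (cj a ` A)"
    using continuous_map_image_closure_subset[OF continuous_cj[OF a]] .
  also have "\<dots> \<subseteq> T closure_of B" using sub by (intro closure_of_mono) blast
  finally show ?thesis using x by blast
qed

section \<open>Attraction to compact stable subgroups\<close>

text \<open>Admitting all integers \<open>i\<close> makes every \<open>ad g i\<close> map
  \<open>C\<close> onto itself.\<close>

definition stable :: "'a \<Rightarrow> 'a set \<Rightarrow> bool" where
  "stable g C \<longleftrightarrow> subgroup C G \<and> compactin T C \<and> (\<forall>c\<in>C. \<forall>i. ad g i c \<in> C)"

text \<open>Convergence of the forward orbit to \<open>\<one>\<close> modulo \<open>C\<close>; for
  trivial \<open>C\<close> this is membership in the contraction group.\<close>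

definition attracted :: "'a \<Rightarrow> 'a \<Rightarrow> 'a set \<Rightarrow> bool" where
  "attracted g x C \<longleftrightarrow>
     x \<in> carrier G \<and> (\<forall>V. co_subgroup V \<longrightarrow> (\<forall>\<^sub>F n in sequentially. ad g (int n) x \<in> V <#> C))"

lemma stableD:
  assumes "stable g C"
  shows "subgroup C G" "compactin T C" "c \<in> C \<Longrightarrow> ad g i c \<in> C" "C \<subseteq> carrier G"
  using assms subgroup.subset unfolding stable_def by auto

text \<open>This is the largest stable subgroup inside \<open>A\<close>; for \<open>A = U\<close> it
  is \<open>U_0\<close>.\<close>

lemma stable_seg_UNIV:
  assumes "subgroup A G" "compactin T A" "g \<in> carrier G"
  shows "stable g (seg g A UNIV)"
  using assms subgroup_seg compactin_seg by (auto simp: stable_def ad_in_seg) (auto simp: seg_def ad_ad)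

text \<open>Longer windows give smaller sets, and the union of the windows gives their intersection,
  so compactness applies.\<close>

lemma compactin_chain_seg:
  assumes A: "compactin T A" and g: "g \<in> carrier G" and I: "\<And>n::nat. I n \<noteq> {}" "mono I"
    and S: "openin T S" "seg g A (\<Union>n. I n) \<subseteq> S"
  shows "\<exists>n. seg g A (I n) \<subseteq> S"
proof -
  have "\<exists>D\<in>range (\<lambda>n. seg g A (I n)). D \<subseteq> S"
  proof (rule compact_directed_Inter_subset[where X = T])
    show cp: "compactin T D" if "D \<in> range (\<lambda>n. seg g A (I n))" for D
      using that compactin_seg[OF A g] I by auto
    then show "closedin T D" if "D \<in> range (\<lambda>n. seg g A (I n))" for D
      using that compactin_closedin by blast
    show "\<exists>C\<in>range (\<lambda>n. seg g A (I n)). C \<subseteq> P \<inter> Q"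
      if PQ: "P \<in> range (\<lambda>n. seg g A (I n))" "Q \<in> range (\<lambda>n. seg g A (I n))" for P Q
    proof -
      obtain m n where mn: "P = seg g A (I m)" "Q = seg g A (I n)" using PQ by blast
      have "I m \<subseteq> I (max m n)" "I n \<subseteq> I (max m n)" using I(2) by (simp_all add: monoD)
      then have "seg g A (I (max m n)) \<subseteq> P \<inter> Q" unfolding mn by (auto simp: seg_def)
      then show ?thesis by blast
    qed
    show "\<Inter>(range (\<lambda>n. seg g A (I n))) \<subseteq> S" using S(2) by (auto simp: seg_def)
  qed (use S in auto)
  then show ?thesis by blast
qed

text \<open>Willis' tidying step: the sets \<open>seg g A {-n-1..-1}\<close> decrease to \<open>seg g A {..-1}\<close>, so one of them lies
  in the open set \<open>V \<cdot> seg g A {..-1}\<close>.\<close>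

lemma tidying:
  assumes A: "subgroup A G" "compactin T A" and g: "g \<in> carrier G"
    and V: "co_subgroup V" and VA: "\<And>x i. x \<in> V \<Longrightarrow> ad g i x \<in> A \<Longrightarrow> x \<in> A"
  shows "\<exists>N::nat. \<forall>a\<in>seg g A {- int N..0}. \<exists>b\<in>seg g A {- int N..0}.
           \<exists>c\<in>seg g A {..0}. a = b \<otimes> c \<and> ad g 1 b \<in> seg g A {- int N..0}"
proof -
  let ?P = "seg g A {..-1}"
  have PG: "?P \<subseteq> carrier G" by (auto simp: seg_def)
  have U: "(\<Union>n. {- int n - 1..-1}) = {..-1}"
  proof (intro equalityI subsetI)
    fix i :: int assume "i \<in> {..-1}"
    then have "i \<in> {- int (nat (- i)) - 1..-1}" by auto
    then show "i \<in> (\<Union>n. {- int n - 1..-1})" by blast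
  qed auto
  have "?P \<subseteq> V <#> ?P" using subset_co_subgroup_mult[OF V PG] .
  moreover have "mono (\<lambda>n. {- int n - 1..-1})" by (auto simp: mono_def)
  ultimately obtain N :: nat where N: "seg g A {- int N - 1..-1} \<subseteq> V <#> ?P"
    using compactin_chain_seg[OF A(2) g, of "\<lambda>n. {- int n - 1..-1}" "V <#> ?P"] U
      openin_set_mult[OF co_subgroupD(3)[OF V] PG] by auto
  show ?thesis
  proof (intro exI[of _ N] ballI)
    fix a assume a: "a \<in> seg g A {- int N..0}"
    then have aG: "a \<in> carrier G" by (simp add: seg_def)
    let ?a = "ad g 1 a"
    \<comment> \<open>Shifting by one step makes the window of \<open>a\<close> end at
      \<open>-1\<close>, leaving room for time 0.\<close>
    have a1: "?a \<in> seg g A {- int N - 1..-1}" using a g aG by (simp add: ad_in_seg) (simp add: seg_def)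
    then obtain v y where vy: "v \<in> V" "y \<in> ?P" "?a = v \<otimes> y" using N unfolding set_mult_def by blast
    have G: "v \<in> carrier G" "y \<in> carrier G" using vy co_subgroup_subset[OF V] PG by auto
    have "y \<in> seg g A {- int N - 1..-1}" using vy(2) by (simp add: seg_def)
    moreover have "v = ?a \<otimes> inv y" using vy G by (simp add: group_rewr)
    ultimately have v1: "v \<in> seg g A {- int N - 1..-1}"
      using a1 subgroup_seg[OF A(1) g] by (simp add: subgroup.m_closed subgroup.m_inv_closed)
    then have "ad g (-1) v \<in> A" by (simp add: seg_def)
    \<comment> \<open>\<open>VA\<close> fills in time 0. The window of \<open>v\<close> then has one
      entry more than needed, so both \<open>?b\<close> and its forward step \<open>v\<close>
      fit.\<close>
    then have "v \<in> A" using VA[OF vy(1)] by blast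
    then have v2: "ad g i v \<in> A" if "i \<in> {- int N - 1..0}" for i
    proof (cases "i = 0")
      case False
      then have "i \<in> {- int N - 1..-1}" using that by auto
      then show ?thesis using v1 by (auto simp: seg_def)
    qed (use \<open>v \<in> A\<close> G in simp)
    let ?b = "ad g (-1) v" and ?c = "ad g (-1) y"
    have "a = ad g (-1) ?a" using g aG by (simp add: ad_ad)
    then have "a = ?b \<otimes> ?c" using vy(3) g G by (simp add: ad_mult)
    moreover have "?b \<in> seg g A {- int N..0}" using v2 g G by (simp add: ad_in_seg)
    moreover have "ad g 1 ?b \<in> seg g A {- int N..0}" using v2 g G by (simp add: ad_ad) (simp add: seg_def)
    moreover have "?c \<in> seg g A {..0}" using vy(2) g G by (simp add: ad_in_seg) (simp add: seg_def)
    ultimately show "\<exists>b\<in>seg g A {- int N..0}. \<exists>c\<in>seg g A {..0}.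
        a = b \<otimes> c \<and> ad g 1 b \<in> seg g A {- int N..0}"
      by blast
  qed
qed

text \<open>Writing \<open>\<alpha>\<^sup>n(x) = q\<^sub>n c\<^sub>n\<close> with small \<open>q\<^sub>n\<close> makes \<open>c\<close> a pseudo-orbit of \<open>\<alpha>\<close> in \<open>C\<close>; a true orbit
  shadowing it yields the correction of \<open>x\<close>.\<close>

lemma attracted_shadow:
  assumes g: "g \<in> carrier G" and C: "stable g C" and x: "attracted g x C" and V: "co_subgroup V"
  shows "\<exists>c\<in>C. \<forall>\<^sub>F n in sequentially. ad g (int n) (x \<otimes> c) \<in> V"
proof -
  note C = stableD[OF C]
  have xG: "x \<in> carrier G" using x by (simp add: attracted_def)
  obtain W where W: "co_subgroup W" "W \<subseteq> V" "\<And>c w. c \<in> C \<Longrightarrow> w \<in> W \<Longrightarrow> cj c w \<in> W"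
    using co_subgroup_normal_core[OF C(2) subgroup.one_closed[OF C(1)] subgroup.m_closed[OF C(1)] V] by blast
  note WG = co_subgroup_subset[OF W(1)]
  define A where "A = W \<inter> C"
  have A: "subgroup A G" "compactin T A"
    unfolding A_def using subgroups_Inter_pair co_subgroupD[OF W(1)] C compact_Int_closedin compactin_closedin
    by blast+
  have adC: "y \<in> C" if "ad g i y \<in> C" "y \<in> carrier G" for i y
    using C(3)[OF that(1), of "- i"] that(2) g by (simp add: ad_ad)
  \<comment> \<open>Membership in \<open>C\<close> is constant along orbits, so at time 0 only
    membership in \<open>W\<close> has to be known.\<close>
  have VA: "y \<in> A" if "y \<in> W" "ad g i y \<in> A" for y and i :: int
    using that adC WG unfolding A_def by blast
  obtain N :: nat where N: "\<And>a. a \<in> seg g A {- int N..0} \<Longrightarrow> \<exists>b\<in>seg g A {- int N..0}.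
           \<exists>c\<in>seg g A {..0}. a = b \<otimes> c \<and> ad g 1 b \<in> seg g A {- int N..0}"
    using tidying[OF A g W(1)] VA by (metis (no_types, lifting))
  define B where "B = seg g A {- int N..0}"
  have B: "subgroup B G" "compactin T B" unfolding B_def using subgroup_seg compactin_seg A g by auto
  have segC: "y \<in> seg g A I" if "y \<in> C" "y \<in> seg g W I" for y I
    using that C(3) by (auto simp: seg_def A_def)
  have normW: "cj c y \<in> seg g W I" if "c \<in> C" "y \<in> seg g W I" for c y I
    using seg_normalized[OF g WG C(4) C(3) W(3) that] .
  define P where "P = seg g W {- int N..0}"
  \<comment> \<open>The window reaches one step beyond that of \<open>P\<close>, so that
    \<open>ad g 1\<close> maps \<open>Q\<close> into \<open>P\<close>.\<close>
  define Q where "Q = seg g W {- int N..1}"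
  have P: "co_subgroup P" and Q: "co_subgroup Q" unfolding P_def Q_def using co_subgroup_seg[OF W(1) g] by auto
  have PW: "y \<in> W" if "y \<in> P" for y using that seg_subset[of "{- int N..0}"] unfolding P_def by auto
  have BP: "y \<in> P" if "y \<in> B" for y using that by (auto simp: seg_def P_def B_def A_def)
  have QP: "Q \<subseteq> P" by (auto simp: seg_def P_def Q_def)
  have QP1: "ad g 1 y \<in> P" if "y \<in> Q" for y
    using that g unfolding P_def Q_def by (auto simp: seg_def ad_ad)
  have PC: "y \<in> B" if "y \<in> P" "y \<in> C" for y using segC that unfolding P_def B_def by blast
  obtain k where k: "\<And>n. n \<ge> k \<Longrightarrow> ad g (int n) x \<in> Q <#> C"
    using x Q unfolding attracted_def eventually_sequentially by blast
  have "\<exists>c. c \<in> C \<and> ad g (int (k + n)) x \<otimes> inv c \<in> Q" for n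
  proof -
    obtain q c where qc: "q \<in> Q" "c \<in> C" "ad g (int (k + n)) x = q \<otimes> c"
      using k[of "k + n"] by (auto simp: set_mult_def)
    have "q \<in> carrier G" "c \<in> carrier G" using qc co_subgroup_subset[OF Q] C(4) by auto
    then have "ad g (int (k + n)) x \<otimes> inv c = q" using qc(3) by (simp add: group_rewr)
    then show ?thesis using qc by auto
  qed
  then obtain c where c: "\<And>n. c n \<in> C" "\<And>n. ad g (int (k + n)) x \<otimes> inv (c n) \<in> Q" by metis
  have cG: "c n \<in> carrier G" for n using c C(4) by blast
  \<comment> \<open>\<open>u n\<close> is the failure of \<open>c\<close> to be an orbit at time
    \<open>n\<close>. It is a conjugate, by an element of \<open>C\<close>, of a quotient of two
    elements of \<open>P\<close>.\<close>
  define u where "u n = inv (c (Suc n)) \<otimes> ad g 1 (c n)" for n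
  have uB: "u n \<in> B" for n
  proof (rule PC)
    show "u n \<in> C" unfolding u_def using c C(3) C(1) by (simp add: subgroup.m_closed subgroup.m_inv_closed)
    let ?q = "ad g (int (k + n)) x \<otimes> inv (c n)" and ?q' = "ad g (int (k + Suc n)) x \<otimes> inv (c (Suc n))"
    have "?q' \<in> P" "ad g 1 ?q \<in> P" using c QP QP1 by blast+
    then have "inv (ad g 1 ?q) \<otimes> ?q' \<in> P"
      using co_subgroupD(1)[OF P] by (simp add: subgroup.m_closed subgroup.m_inv_closed)
    then have "cj (inv (c (Suc n))) (inv (ad g 1 ?q) \<otimes> ?q') \<in> P"
      using normW subgroup.m_inv_closed[OF C(1) c(1)] unfolding P_def by blast
    moreover have "ad g 1 (ad g (int (k + n)) x) = ad g (int (k + Suc n)) x"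
      using g xG by (simp add: ad_ad algebra_simps)
    then have "cj (inv (c (Suc n))) (inv (ad g 1 ?q) \<otimes> ?q') = u n"
      using g xG cG by (simp add: u_def ad_mult ad_inv cj_def group_rewr)
    ultimately show "u n \<in> P" by simp
  qed
  \<comment> \<open>This rewrites the pseudo-orbit as a product of factors
    \<open>u n \<otimes> g\<close>, the form that \<open>shadow\<close> takes; the factor
    \<open>c 0\<close> makes it start at \<open>\<one>\<close>.\<close>
  define h where "h n = inv (c n) \<otimes> (g [^] int n) \<otimes> c 0" for n
  have "\<exists>z\<in>B. \<forall>n. h n \<otimes> inv z \<otimes> inv (g [^] int n) \<in> B"
  proof (rule shadow[where u = u])
    show "subgroup B G" "compactin T B" "g \<in> carrier G" "u n \<in> B" for n using B g uB by auto
    show "h 0 = \<one>" using cG by (simp add: h_def)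
    show "h (Suc n) = u n \<otimes> g \<otimes> h n" for n
      using g cG int_pow_mult[OF g, of 1 "int n"] by (simp add: h_def u_def ad_def cj_def group_rewr)
    show "\<exists>b\<in>B. \<exists>c\<in>seg g B {..0}. a = b \<otimes> c \<and> ad g 1 b \<in> B" if aB: "a \<in> B" for a
    proof -
      obtain b c where bc: "b \<in> B" "c \<in> seg g A {..0}" "a = b \<otimes> c" "ad g 1 b \<in> B"
        using N aB unfolding B_def by blast
      have "c \<in> carrier G" using bc(2) by (simp add: seg_def)
      moreover have "ad g i c \<in> B" if "i \<le> 0" for i
        using bc(2) that g \<open>c \<in> carrier G\<close> unfolding B_def by (simp add: ad_in_seg) (simp add: seg_def)
      ultimately have "c \<in> seg g B {..0}" by (simp add: seg_def)
      then show ?thesis using bc by blast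
    qed
  qed
  then obtain z where z: "z \<in> B" "\<And>n. h n \<otimes> inv z \<otimes> inv (g [^] int n) \<in> B" by blast
  have BG: "B \<subseteq> carrier G" using subgroup.subset[OF B(1)] .
  have zG: "z \<in> carrier G" using z BG by blast
  have "B \<subseteq> C" using seg_subset[of "{- int N..0}" g A] unfolding B_def A_def by auto
  then have zC: "z \<in> C" using z by blast
  let ?c = "z \<otimes> inv (c 0)"
  have cC: "?c \<in> C" using zC c C(1) by (simp add: subgroup.m_closed subgroup.m_inv_closed)
  have cG': "?c \<in> carrier G" using cC C(4) by blast
  \<comment> \<open>The time shift by \<open>k\<close> is undone: at time \<open>k + n\<close> the
    correction \<open>d\<close> has become \<open>ad g (int n) ?c\<close>.\<close>
  define d where "d = ad g (- int k) ?c"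
  have "d \<in> C" unfolding d_def using C(3) cC by blast
  moreover have "ad g (int (k + n)) (x \<otimes> d) \<in> W" for n
  proof -
    let ?q = "ad g (int (k + n)) x \<otimes> inv (c n)"
    let ?b = "inv (h n \<otimes> inv z \<otimes> inv (g [^] int n))"
    have "?b \<in> B" using z subgroup.m_inv_closed[OF B(1)] by blast
    then have "cj (c n) ?b \<in> W" using BP PW W(3) c by blast
    moreover have "?q \<in> W" using c QP PW by blast
    moreover have "ad g (int (k + n)) d = ad g (int n) ?c"
      using g cG' by (simp add: d_def ad_ad)
    then have "ad g (int (k + n)) (x \<otimes> d) = ?q \<otimes> cj (c n) ?b"
      using g xG cG zG cG' C(4) \<open>d \<in> C\<close>
      by (simp add: ad_mult subset_iff) (simp add: ad_def cj_def h_def group_rewr)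
    ultimately show ?thesis using subgroup.m_closed[OF co_subgroupD(1)[OF W(1)]] by simp
  qed
  then have "\<forall>\<^sub>F n in sequentially. ad g (int n) (x \<otimes> d) \<in> V"
    unfolding eventually_sequentially using W(2) by (metis le_Suc_ex subsetD)
  ultimately show ?thesis by blast
qed

lemma attracted_mult:
  assumes g: "g \<in> carrier G" and C: "stable g C" and x: "attracted g x C" and c: "c \<in> C"
  shows "attracted g (x \<otimes> c) C"
  unfolding attracted_def
proof (intro conjI allI impI)
  note C = stableD[OF C]
  have xG: "x \<in> carrier G" and cG: "c \<in> carrier G" using x c C(4) by (auto simp: attracted_def)
  then show "x \<otimes> c \<in> carrier G" by simp
  fix V assume V: "co_subgroup V"
  then have "\<forall>\<^sub>F n in sequentially. ad g (int n) x \<in> V <#> C" using x by (simp add: attracted_def)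
  then show "\<forall>\<^sub>F n in sequentially. ad g (int n) (x \<otimes> c) \<in> V <#> C"
  proof eventually_elim
    case (elim n)
    then obtain v d where vd: "v \<in> V" "d \<in> C" "ad g (int n) x = v \<otimes> d" by (auto simp: set_mult_def)
    then have "ad g (int n) (x \<otimes> c) = v \<otimes> (d \<otimes> ad g (int n) c)"
      using g xG cG co_subgroup_subset[OF V] C(4) by (simp add: ad_mult m_assoc subset_iff)
    moreover have "d \<otimes> ad g (int n) c \<in> C" using vd c C(3) subgroup.m_closed[OF C(1)] by blast
    ultimately show ?case using vd unfolding set_mult_def by blast
  qed
qed

text \<open>After the correction by \<open>attracted_shadow\<close> the orbit eventually stays in
  \<open>V\<close>. Its \<open>C\<close>-part modulo a small group then stays in \<open>V\<close>
  over a long window of times, and by compactness such elements of \<open>C\<close> are close to the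
  stable part of \<open>C \<inter> V\<close>.\<close>

lemma attracted_refine:
  assumes g: "g \<in> carrier G" and C: "stable g C" and x: "attracted g x C" and V: "co_subgroup V"
  shows "\<exists>c\<in>C. attracted g (x \<otimes> c) (seg g (C \<inter> V) UNIV)"
proof -
  obtain c where c: "c \<in> C" "\<forall>\<^sub>F n in sequentially. ad g (int n) (x \<otimes> c) \<in> V"
    using attracted_shadow[OF assms] by blast
  let ?y = "x \<otimes> c" and ?D = "seg g (C \<inter> V) UNIV"
  have y: "attracted g ?y C" using attracted_mult[OF g C x c(1)] .
  note C = stableD[OF C]
  have yG: "?y \<in> carrier G" using y by (simp add: attracted_def)
  have cp: "compactin T (C \<inter> V)"
    using C(2) compact_Int_closedin compactin_closedin[OF co_subgroupD(2)[OF V]] by blast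
  have "attracted g ?y ?D"
    unfolding attracted_def
  proof (intro conjI allI impI)
    show "?y \<in> carrier G" by fact
    fix W assume W: "co_subgroup W"
    have DG: "?D \<subseteq> carrier G" by (auto simp: seg_def)
    have sub: "?D \<subseteq> W <#> ?D" using subset_co_subgroup_mult[OF W DG] .
    have "mono (\<lambda>n. {- int n..int n})" by (auto simp: mono_def)
    moreover have "(\<Union>n. {- int n..int n}) = UNIV"
    proof (intro equalityI subsetI)
      fix i :: int
      have "i \<in> {- int (nat \<bar>i\<bar>)..int (nat \<bar>i\<bar>)}" by auto
      then show "i \<in> (\<Union>n. {- int n..int n})" by blast
    qed auto
    ultimately obtain m :: nat where m: "seg g (C \<inter> V) {- int m..int m} \<subseteq> W <#> ?D"
      using compactin_chain_seg[OF cp g, of "\<lambda>n. {- int n..int n}" "W <#> ?D"] sub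
        openin_set_mult[OF co_subgroupD(3)[OF W] DG] by auto
    define Vm where "Vm = seg g V {- int m..int m}"
    have Vm: "co_subgroup Vm" unfolding Vm_def using co_subgroup_seg[OF V g] by simp
    obtain k where k: "\<And>n. n \<ge> k \<Longrightarrow> ad g (int n) ?y \<in> V"
      using c(2) unfolding eventually_sequentially by blast
    \<comment> \<open>The offset \<open>m\<close> keeps the whole window from \<open>n - m\<close>
      to \<open>n + m\<close> beyond \<open>k\<close>.\<close>
    have in_Vm: "ad g (int n) ?y \<in> Vm" if "n \<ge> k + m" for n
      unfolding Vm_def ad_in_seg[OF g yG]
    proof
      fix i assume i: "i \<in> {- int m..int m}"
      have "ad g (int (nat (i + int n))) ?y \<in> V" using i that by (intro k) auto
      then show "ad g (i + int n) ?y \<in> V" using i that by simp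
    qed
    have WV: "co_subgroup (W \<inter> Vm)" using W Vm by (rule co_subgroup_Int)
    then have "\<forall>\<^sub>F n in sequentially. ad g (int n) ?y \<in> (W \<inter> Vm) <#> C"
      using y by (simp add: attracted_def)
    moreover have "\<forall>\<^sub>F n in sequentially. ad g (int n) ?y \<in> Vm"
      using in_Vm unfolding eventually_sequentially by blast
    ultimately show "\<forall>\<^sub>F n in sequentially. ad g (int n) ?y \<in> W <#> ?D"
    proof eventually_elim
      case (elim n)
      then obtain w d where wd: "w \<in> W \<inter> Vm" "d \<in> C" "ad g (int n) ?y = w \<otimes> d"
        by (auto simp: set_mult_def)
      have G: "w \<in> carrier G" "d \<in> carrier G" using wd co_subgroup_subset[OF W] C(4) by auto
      have "d = inv w \<otimes> ad g (int n) ?y" using wd(3) G by (simp add: group_rewr)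
      moreover have "inv w \<otimes> ad g (int n) ?y \<in> Vm"
        using wd(1) elim(2) subgroup.m_closed[OF co_subgroupD(1)[OF Vm] subgroup.m_inv_closed[OF co_subgroupD(1)[OF Vm]]]
        by blast
      ultimately have "d \<in> Vm" by (rule ssubst)
      then have "d \<in> seg g (C \<inter> V) {- int m..int m}"
        using wd C(3) unfolding Vm_def by (simp add: seg_def)
      then obtain w' e where we: "w' \<in> W" "e \<in> ?D" "d = w' \<otimes> e" using m unfolding set_mult_def by blast
      have "w' \<in> carrier G" "e \<in> carrier G" using we co_subgroup_subset[OF W] DG by auto
      then have "ad g (int n) ?y = (w \<otimes> w') \<otimes> e" using wd we G by (simp add: m_assoc)
      moreover have "w \<otimes> w' \<in> W" using wd we subgroup.m_closed[OF co_subgroupD(1)[OF W]] by blast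
      ultimately show ?case using we unfolding set_mult_def by blast
    qed
  qed
  then show ?thesis using c(1) by blast
qed

end

section \<open>Equivariance under conjugation, and the link with \<open>tidy\<close> and
  \<open>normalizer\<close>\<close>

context group
begin

lemma pow_cj:
  assumes "x \<in> carrier G" "h \<in> carrier G"
  shows "cj x h [^] (i::int) = cj x (h [^] i)"
proof -
  have nat: "cj x h [^] n = cj x (h [^] n)" for n :: nat
    using assms by (induction n) (simp_all add: cj_mult)
  show ?thesis
  proof (cases i rule: int_cases2)
    case (nonneg n)
    then show ?thesis by (simp add: int_pow_int nat)
  next
    case (nonpos n)
    then show ?thesis using assms by (simp only: int_pow_neg_int cj_closed nat cj_inv nat_pow_closed)
  qed
qed

lemma ad_cj:
  assumes "x \<in> carrier G" "h \<in> carrier G" "s \<in> carrier G"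
  shows "ad (cj x h) i (cj x s) = cj x (ad h i s)"
proof -
  define p where "p = h [^] i"
  have "p \<in> carrier G" using assms by (simp add: p_def)
  then show ?thesis
    using assms unfolding ad_def pow_cj[OF assms(1,2)] p_def[symmetric]
    by (simp add: cj_def group_rewr)
qed

text \<open>Transport of structure along conjugation by \<open>x\<close>: the set is
  \<open>x U x^-1\<close>, written as a preimage.\<close>

lemma tidy_above_cj:
  assumes x: "x \<in> carrier G" and h: "h \<in> carrier G" and U: "U \<subseteq> carrier G" and t: "tidy_above h U"
  shows "tidy_above (cj x h) {y \<in> carrier G. cj (inv x) y \<in> U}"
  unfolding tidy_above_def
proof
  let ?V = "{y \<in> carrier G. cj (inv x) y \<in> U}"
  have seg: "cj x a \<in> seg (cj x h) ?V I" if "a \<in> seg h U I" for a I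
    using that x h by (auto simp: seg_def ad_cj)
  fix y assume y: "y \<in> ?V"
  then obtain a b where ab: "a \<in> seg h U {0..}" "b \<in> seg h U {..0}" "cj (inv x) y = a \<otimes> b"
    using t unfolding tidy_above_def by blast
  have "y = cj x (cj (inv x) y)" using y x by simp
  also have "\<dots> = cj x a \<otimes> cj x b" using ab x by (simp add: cj_mult seg_def)
  finally show "\<exists>a\<in>seg (cj x h) ?V {0..}. \<exists>b\<in>seg (cj x h) ?V {..0}. y = a \<otimes> b"
    using seg ab by blast
qed

text \<open>An image under a power is a condition on the opposite power, so \<open>U_plus\<close>
  and \<open>U_minus\<close> are half-line groups of \<open>inv k\<close>. In this order they give
  \<open>tidy_above\<close> for \<open>inv k\<close>, and \<open>tidy_above_inv\<close> returns to
  \<open>k\<close>.\<close>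

lemma tidy_imp_tidy_above:
  assumes k: "k \<in> carrier G" and t: "tidy G T (inner_aut G k) U"
  shows "tidy_above k U"
proof -
  have U: "subgroup U G" using t by (simp add: tidy_def compact_open_subgroup_def)
  have UG: "U \<subseteq> carrier G" using subgroup.subset[OF U] .
  have mem: "ad k (- n) a \<in> U \<and> a \<in> carrier G" if "a \<in> (inner_aut G k [^]\<^bsub>AutoGroup G\<^esub> n) ` U" for a n
  proof -
    obtain y where y: "y \<in> U" "a = inner_aut G (k [^] n) y"
      using \<open>a \<in> _\<close> by (auto simp: inner_aut_int_pow[OF k])
    then have yG: "y \<in> carrier G" using UG by blast
    then have "a = ad k n y" using y by (simp add: inner_aut_def ad_def cj_def)
    then show ?thesis using y k yG by (simp add: ad_ad)
  qed
  have "tidy_above (inv k) U"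
    unfolding tidy_above_def
  proof
    fix x assume "x \<in> U"
    then obtain a b where ab: "a \<in> U_plus G (inner_aut G k) U" "b \<in> U_minus G (inner_aut G k) U" "x = a \<otimes> b"
      using t unfolding tidy_def set_mult_def by blast
    have a: "ad k (- n) a \<in> U \<and> a \<in> carrier G" if "n \<ge> 0" for n
      using ab(1) mem that unfolding U_plus_def by blast
    have b: "ad k (- n) b \<in> U \<and> b \<in> carrier G" if "n \<le> 0" for n
      using ab(2) mem that unfolding U_minus_def by blast
    have "a \<in> seg (inv k) U {0..}" using a k by (force simp: seg_def ad_inv_left)
    moreover have "b \<in> seg (inv k) U {..0}" using b k by (force simp: seg_def ad_inv_left)
    ultimately show "\<exists>a\<in>seg (inv k) U {0..}. \<exists>b\<in>seg (inv k) U {..0}. x = a \<otimes> b"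
      using ab(3) by blast
  qed
  then show ?thesis using tidy_above_inv[OF U, of "inv k"] k by simp
qed

text \<open>The normalizer is a stabilizer of sets, so \<open>cj w\<close> has to map
  \<open>M\<close> onto \<open>M\<close>; the condition on \<open>inv w\<close> gives
  surjectivity.\<close>

lemma mem_normalizerI:
  assumes M: "M \<subseteq> carrier G" and w: "w \<in> carrier G"
    and cj: "\<And>x. x \<in> M \<Longrightarrow> cj w x \<in> M" "\<And>x. x \<in> M \<Longrightarrow> cj (inv w) x \<in> M"
  shows "w \<in> normalizer G M"
proof -
  have "w <# M #> inv w = cj w ` M" by (auto simp: l_coset_def r_coset_def cj_def)
  also have "\<dots> = M"
  proof (intro equalityI subsetI)
    fix x assume "x \<in> M"
    then have "x = cj w (cj (inv w) x)" using M w by auto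
    then show "x \<in> cj w ` M" using cj(2) \<open>x \<in> M\<close> by blast
  qed (auto intro: cj(1))
  finally show ?thesis using M w by (simp add: normalizer_def stabilizer_def)
qed

end

text \<open>This is the relative Tits core of the cyclic group generated by
  \<open>g\<close>.\<close>

definition (in topological_group) core :: "'a \<Rightarrow> 'a set" where
  "core g = generate G (T closure_of con G T g \<union> T closure_of con G T (inv g))"

context tdlc_group
begin

lemma co_subgroup_mult_absorb:
  assumes "co_subgroup V" "D \<subseteq> carrier G" "E \<subseteq> V <#> D" "y \<in> V <#> E"
  shows "y \<in> V <#> D"
proof -
  obtain v e where ve: "v \<in> V" "e \<in> E" "y = v \<otimes> e" using assms(4) by (auto simp: set_mult_def)
  then obtain w d where wd: "w \<in> V" "d \<in> D" "e = w \<otimes> d" using assms(3) unfolding set_mult_def by blast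
  have "y = (v \<otimes> w) \<otimes> d" using ve wd co_subgroup_subset[OF assms(1)] assms(2) by (simp add: m_assoc subset_iff)
  moreover have "v \<otimes> w \<in> V" using subgroup.m_closed[OF co_subgroupD(1)[OF assms(1)] ve(1) wd(1)] .
  ultimately show ?thesis using wd(2) unfolding set_mult_def by blast
qed

text \<open>By compactness some member of the chain lies in \<open>V <#> \<Inter>\<D>\<close>, and
  \<open>V\<close> absorbs the additional factor. This supplies the lower bounds for the Zorn
  argument.\<close>

lemma attracted_chain_Inter:
  assumes g: "g \<in> carrier G" and ne: "\<D> \<noteq> {}"
    and st: "\<And>D. D \<in> \<D> \<Longrightarrow> stable g D" and att: "\<And>D. D \<in> \<D> \<Longrightarrow> attracted g y D"
    and chain: "\<And>D E. D \<in> \<D> \<Longrightarrow> E \<in> \<D> \<Longrightarrow> D \<subseteq> E \<or> E \<subseteq> D"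
  shows "stable g (\<Inter>\<D>)" "attracted g y (\<Inter>\<D>)"
proof -
  obtain D0 where D0: "D0 \<in> \<D>" using ne by blast
  have clo: "closedin T D" if "D \<in> \<D>" for D using stableD(2)[OF st[OF that]] compactin_closedin by blast
  have sub: "\<Inter>\<D> \<subseteq> carrier G" using stableD(4)[OF st[OF D0]] D0 by blast
  show "stable g (\<Inter>\<D>)"
    unfolding stable_def
  proof (intro conjI ballI allI)
    show "subgroup (\<Inter>\<D>) G" using subgroups_Inter[OF stableD(1)[OF st] ne] .
    show "compactin T (\<Inter>\<D>)"
      using closed_compactin_Inter[OF stableD(2)[OF st[OF D0]] D0 clo] .
    show "ad g i c \<in> \<Inter>\<D>" if "c \<in> \<Inter>\<D>" for c i using that stableD(3)[OF st] by blast
  qed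
  show "attracted g y (\<Inter>\<D>)"
    unfolding attracted_def
  proof (intro conjI allI impI)
    show "y \<in> carrier G" using att[OF D0] by (simp add: attracted_def)
    fix V assume V: "co_subgroup V"
    have "\<exists>D\<in>\<D>. D \<subseteq> V <#> \<Inter>\<D>"
    proof (rule compact_directed_Inter_subset[where X = T])
      show "compactin T D" if "D \<in> \<D>" for D using stableD(2)[OF st[OF that]] .
      show "\<exists>C\<in>\<D>. C \<subseteq> A \<inter> B" if "A \<in> \<D>" "B \<in> \<D>" for A B
        using chain[OF that] that by blast
      show "openin T (V <#> \<Inter>\<D>)" using openin_set_mult[OF co_subgroupD(3)[OF V] sub] .
      show "\<Inter>\<D> \<subseteq> V <#> \<Inter>\<D>" using subset_co_subgroup_mult[OF V sub] .
    qed (use clo ne in auto)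
    then obtain D where D: "D \<in> \<D>" "D \<subseteq> V <#> \<Inter>\<D>" by blast
    have "\<forall>\<^sub>F n in sequentially. ad g (int n) y \<in> V <#> D" using att[OF D(1)] V by (simp add: attracted_def)
    then show "\<forall>\<^sub>F n in sequentially. ad g (int n) y \<in> V <#> \<Inter>\<D>"
      by (rule eventually_mono) (rule co_subgroup_mult_absorb[OF V sub D(2)])
  qed
qed

text \<open>Zorn on the cosets \<open>c D\<close> such that \<open>x c\<close> is attracted to \<open>D\<close>: a minimal one has trivial \<open>D\<close>.\<close>

lemma attracted_imp_con:
  assumes g: "g \<in> carrier G" and C: "stable g C" and x: "attracted g x C"
  shows "\<exists>c\<in>C. x \<otimes> c \<in> con G T g"
proof -
  \<comment> \<open>The correction \<open>c\<close> changes along a descent, so cosets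
    \<open>c D\<close> are ordered rather than the groups \<open>D\<close>; nested compact cosets
    still share a point.\<close>
  define \<S> where "\<S> = {S. \<exists>c D. c \<in> C \<and> stable g D \<and> D \<subseteq> C \<and> attracted g (x \<otimes> c) D \<and> S = c <# D}"
  \<comment> \<open>Any point \<open>e\<close> of a coset may represent it, and \<open>E e S\<close>
    recovers the group from the coset.\<close>
  define E where "E e S = {y \<in> carrier G. e \<otimes> y \<in> S}" for e S
  note CG = stableD(4)[OF C]
  have xG: "x \<in> carrier G" using x by (simp add: attracted_def)
  have base: "e \<in> C \<and> stable g (E e S) \<and> E e S \<subseteq> C \<and> attracted g (x \<otimes> e) (E e S) \<and> S = e <# E e S"
    if S: "S \<in> \<S>" and eS: "e \<in> S" for S e
  proof -
    obtain c D where cD: "c \<in> C" "stable g D" "D \<subseteq> C" "attracted g (x \<otimes> c) D" "S = c <# D"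
      using S by (auto simp: \<S>_def)
    note D = stableD[OF cD(2)]
    obtain d where d: "d \<in> D" "e = c \<otimes> d" using eS cD(5) by (auto simp: l_coset_def)
    have G: "c \<in> carrier G" "d \<in> carrier G" using cD(1) CG d D(4) by auto
    have "E e S = D"
    proof (intro equalityI subsetI)
      fix y assume "y \<in> E e S"
      then obtain d' where d': "d' \<in> D" "y \<in> carrier G" "c \<otimes> d \<otimes> y = c \<otimes> d'"
        by (auto simp: E_def cD(5) l_coset_def d(2))
      have "d' \<in> carrier G" using d' D(4) by blast
      then have "d \<otimes> y = d'" using d' G by (simp add: m_assoc)
      then have "y = inv d \<otimes> d'" using d' G by (simp add: group_rewr flip: \<open>d \<otimes> y = d'\<close>)
      then show "y \<in> D" using d d' subgroup.m_closed[OF D(1) subgroup.m_inv_closed[OF D(1)]] by blast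
    next
      fix y assume y: "y \<in> D"
      then have "y \<in> carrier G" "d \<otimes> y \<in> D" using D(4) d subgroup.m_closed[OF D(1)] by auto
      then show "y \<in> E e S" using G by (auto simp: E_def cD(5) l_coset_def d(2) m_assoc)
    qed
    moreover have "attracted g (x \<otimes> e) D"
      using attracted_mult[OF g cD(2,4) d(1)] xG G by (simp add: d(2) m_assoc)
    moreover have "e \<in> C" using d cD subgroup.m_closed[OF stableD(1)[OF C]] by blast
    moreover have "S \<subseteq> carrier G" unfolding cD(5) using G D(4) l_coset_subset_G by blast
    then have "S = e <# E e S"
    proof (intro equalityI subsetI)
      fix s assume "s \<in> S" "S \<subseteq> carrier G"
      moreover have "e \<in> carrier G" using G d by simp
      ultimately have "s = e \<otimes> (inv e \<otimes> s)" "inv e \<otimes> s \<in> E e S"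
        by (auto simp: E_def inv_mult_cancel subset_iff)
      then show "s \<in> e <# E e S" by (auto simp: l_coset_def)
    qed (auto simp: l_coset_def E_def)
    ultimately show ?thesis using cD by metis
  qed
  have ne: "S \<noteq> {}" if S: "S \<in> \<S>" for S
  proof -
    obtain c D where "S = c <# D" "stable g D" using S by (auto simp: \<S>_def)
    then show ?thesis using subgroup.one_closed[OF stableD(1)] by (fastforce simp: l_coset_def)
  qed
  have cpt: "compactin T S" if S: "S \<in> \<S>" for S
  proof -
    obtain c D where cD: "S = c <# D" "stable g D" "c \<in> carrier G" using S CG by (auto simp: \<S>_def)
    have "continuous_map T T (\<lambda>y. c \<otimes> y)" using cD(3) by (intro continuous_group_intros)
    moreover have "S = (\<lambda>y. c \<otimes> y) ` D" by (auto simp: cD(1) l_coset_def)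
    ultimately show ?thesis using image_compactin[OF stableD(2)[OF cD(2)]] by simp
  qed
  have "\<exists>S\<in>\<S>. \<forall>S'\<in>\<S>. S' \<subseteq> S \<longrightarrow> S' = S"
  proof (rule predicate_Zorn)
    show "partial_order_on \<S> (relation_of (\<lambda>S S'. S' \<subseteq> S) \<S>)"
      by (rule partial_order_on_relation_ofI) auto
    fix \<C> assume "\<C> \<in> Chains (relation_of (\<lambda>S S'. S' \<subseteq> S) \<S>)"
    then have ch: "A \<in> \<S>" "A \<subseteq> B \<or> B \<subseteq> A" if "A \<in> \<C>" "B \<in> \<C>" for A B
      using that by (auto simp: Chains_def relation_of_def)
    show "\<exists>S\<in>\<S>. \<forall>A\<in>\<C>. S \<subseteq> A"
    proof (cases "\<C> = {}")
      case True
      have "\<one> <# C \<in> \<S>"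
        unfolding \<S>_def mem_Collect_eq
        using C x xG subgroup.one_closed[OF stableD(1)[OF C]]
        by (intro exI[of _ \<one>] exI[of _ C]) simp
      then show ?thesis using True by blast
    next
      case False
      \<comment> \<open>A common point represents all cosets of the chain at once, which reduces the
        chain to one of groups.\<close>
      have "\<Inter>\<C> \<noteq> {}"
      proof
        assume e: "\<Inter>\<C> = {}"
        have "\<exists>D\<in>\<C>. D \<subseteq> {}"
        proof (rule compact_directed_Inter_subset[where X = T])
          show cp: "compactin T D" if "D \<in> \<C>" for D using cpt ch that by blast
          then show "closedin T D" if "D \<in> \<C>" for D using compactin_closedin that by blast
          show "\<exists>D\<in>\<C>. D \<subseteq> A \<inter> B" if "A \<in> \<C>" "B \<in> \<C>" for A B using ch(2)[OF that] that by blast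
        qed (use e False in auto)
        then show False using ch ne by blast
      qed
      then obtain e where e: "e \<in> \<Inter>\<C>" by blast
      have b: "e \<in> C \<and> stable g (E e S) \<and> E e S \<subseteq> C \<and> attracted g (x \<otimes> e) (E e S) \<and> S = e <# E e S"
        if S: "S \<in> \<C>" for S using base[OF ch(1)[OF S S]] e S by blast
      have chE: "P \<subseteq> Q \<or> Q \<subseteq> P" if PQ: "P \<in> E e ` \<C>" "Q \<in> E e ` \<C>" for P Q
      proof -
        obtain A B where AB: "A \<in> \<C>" "B \<in> \<C>" "P = E e A" "Q = E e B" using PQ by blast
        then show ?thesis using ch(2)[OF AB(1,2)] unfolding E_def by blast
      qed
      let ?D = "\<Inter>(E e ` \<C>)"
      have "stable g ?D" "attracted g (x \<otimes> e) ?D"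
        using attracted_chain_Inter[OF g, of "E e ` \<C>" "x \<otimes> e"] chE b False by auto
      moreover have "?D \<subseteq> C" "e \<in> C" using b False by blast+
      ultimately have "e <# ?D \<in> \<S>" unfolding \<S>_def by blast
      moreover have "e <# ?D \<subseteq> A" if "A \<in> \<C>" for A
        using that unfolding l_coset_def E_def by auto
      ultimately show ?thesis by blast
    qed
  qed
  then obtain S where S: "S \<in> \<S>" "\<And>S'. S' \<in> \<S> \<Longrightarrow> S' \<subseteq> S \<Longrightarrow> S' = S" by blast
  from S(1) obtain c D where cD: "c \<in> C" "stable g D" "D \<subseteq> C" "attracted g (x \<otimes> c) D" "S = c <# D"
    by (auto simp: \<S>_def)
  note D = stableD[OF cD(2)]
  have cG: "c \<in> carrier G" using cD CG by blast
  have D1: "d = \<one>" if d: "d \<in> D" for d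
  proof (rule ccontr)
    assume "d \<noteq> \<one>"
    have dG: "d \<in> carrier G" using d D(4) by blast
    have "openin T (carrier G - {d})"
      using closedin_Hausdorff_singleton[OF Hausdorff] dG by (auto simp: closedin_def topspace_eq_carrier)
    then obtain V where V: "co_subgroup V" "V \<subseteq> carrier G - {d}"
      using van_Dantzig[of "carrier G - {d}"] \<open>d \<noteq> \<one>\<close> by auto
    obtain e where e: "e \<in> D" "attracted g (x \<otimes> c \<otimes> e) (seg g (D \<inter> V) UNIV)"
      using attracted_refine[OF g cD(2,4) V(1)] by blast
    let ?D = "seg g (D \<inter> V) UNIV"
    have eG: "e \<in> carrier G" using e D(4) by blast
    have sD: "?D \<subseteq> D \<inter> V" by (rule seg_subset) simp
    have "stable g ?D"
      using stable_seg_UNIV[OF _ _ g] subgroups_Inter_pair[OF D(1) co_subgroupD(1)[OF V(1)]]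
        compact_Int_closedin[OF D(2) compactin_closedin[OF co_subgroupD(2)[OF V(1)]]] by blast
    moreover have "attracted g (x \<otimes> (c \<otimes> e)) ?D" using e(2) xG cG eG by (simp add: m_assoc)
    moreover have "c \<otimes> e \<in> C" using cD e subgroup.m_closed[OF stableD(1)[OF C]] by blast
    ultimately have "(c \<otimes> e) <# ?D \<in> \<S>" using sD cD(3) unfolding \<S>_def by blast
    moreover have "(c \<otimes> e) <# ?D \<subseteq> S"
    proof
      fix s assume "s \<in> (c \<otimes> e) <# ?D"
      then obtain y where y: "y \<in> D" "s = c \<otimes> e \<otimes> y" using sD by (auto simp: l_coset_def)
      then have "s = c \<otimes> (e \<otimes> y)" using cG eG D(4) by (auto simp: m_assoc)
      then show "s \<in> S" using y e subgroup.m_closed[OF D(1)] unfolding cD(5) l_coset_def by blast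
    qed
    ultimately have "(c \<otimes> e) <# ?D = S" by (rule S(2))
    moreover have "c \<otimes> (e \<otimes> d) \<in> S"
      using e d subgroup.m_closed[OF D(1)] unfolding cD(5) l_coset_def by blast
    \<comment> \<open>By minimality the refined coset is all of \<open>S\<close>, so it contains
      \<open>c e d\<close>. Cancellation puts \<open>d\<close> into \<open>V\<close>, which was
      chosen to avoid it.\<close>
    ultimately obtain y where y: "y \<in> ?D" "c \<otimes> (e \<otimes> d) = c \<otimes> e \<otimes> y" by (auto simp: l_coset_def)
    have "y \<in> carrier G" using y by (simp add: seg_def)
    then have "d = y" using y(2) cG eG dG by (simp add: m_assoc)
    then show False using y sD V(2) by blast
  qed
  have "x \<otimes> c \<in> con G T g"
    unfolding con_iff[OF g]
  proof (intro conjI allI impI)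
    show "x \<otimes> c \<in> carrier G" using xG cG by simp
    fix V assume V: "co_subgroup V"
    then have "\<forall>\<^sub>F n in sequentially. ad g (int n) (x \<otimes> c) \<in> V <#> D"
      using cD(4) by (simp add: attracted_def)
    then show "\<forall>\<^sub>F n in sequentially. ad g (int n) (x \<otimes> c) \<in> V"
    proof (rule eventually_mono)
      fix n assume "ad g (int n) (x \<otimes> c) \<in> V <#> D"
      then obtain v d where "v \<in> V" "d \<in> D" "ad g (int n) (x \<otimes> c) = v \<otimes> d"
        by (auto simp: set_mult_def)
      then show "ad g (int n) (x \<otimes> c) \<in> V" using D1[of d] co_subgroup_subset[OF V] by auto
    qed
  qed
  then show ?thesis using cD(1) by blast
qed

section \<open>Normalization and perturbation invariance of \<open>core\<close>\<close>

lemma core_inv: "g \<in> carrier G \<Longrightarrow> core (inv g) = core g"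
  by (simp add: core_def Un_commute)

lemma core_generators_subset: "T closure_of con G T g \<union> T closure_of con G T (inv g) \<subseteq> carrier G"
  using closure_con_subset by blast

lemma subgroup_core: "subgroup (core g) G"
  unfolding core_def by (rule generate_is_subgroup[OF core_generators_subset])

lemma core_subset: "core g \<subseteq> carrier G"
  using subgroup.subset[OF subgroup_core] .

lemma closure_con_core: "T closure_of con G T g \<subseteq> core g" "T closure_of con G T (inv g) \<subseteq> core g"
  unfolding core_def by (auto intro: generate.incl)

lemma con_core: "con G T g \<subseteq> core g"
proof -
  have "con G T g \<subseteq> T closure_of con G T g"
    using con_subset by (intro closure_of_subset) (simp add: topspace_eq_carrier)
  then show ?thesis using closure_con_core(1) by (rule subset_trans)
qed

lemma core_cjI:
  assumes "u \<in> carrier G" "subgroup D G"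
    and "\<And>s. s \<in> T closure_of con G T g \<Longrightarrow> cj u s \<in> D"
    and "\<And>s. s \<in> T closure_of con G T (inv g) \<Longrightarrow> cj u s \<in> D"
    and "x \<in> core g"
  shows "cj u x \<in> D"
proof (rule generate_cj[OF assms(1) core_generators_subset assms(2)])
  show "cj u s \<in> D" if "s \<in> T closure_of con G T g \<union> T closure_of con G T (inv g)" for s
    using that by (elim UnE assms(3,4))
qed (use assms(5) in \<open>simp add: core_def\<close>)

text \<open>Attraction of \<open>a\<close> to the stable group \<open>?C\<close> gives
  \<open>c\<close> in \<open>?C\<close> with \<open>a \<otimes> c\<close> in the contraction group,
  hence in \<open>core g\<close>. The other factor \<open>inv c\<close> normalizes both contraction
  groups, as its whole orbit stays in \<open>U\<close>.\<close>

lemma seg_normalizes_core: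
  assumes U: "co_subgroup U" and g: "g \<in> carrier G" and a: "a \<in> seg g U {0..}" and x: "x \<in> core g"
  shows "cj a x \<in> core g"
proof -
  note U' = co_subgroupD(1,2)[OF U]
  let ?C = "seg g U UNIV"
  have aG: "a \<in> carrier G" using a by (simp add: seg_def)
  have xG: "x \<in> carrier G" using x core_subset by blast
  have C: "stable g ?C" using stable_seg_UNIV[OF U' g] .
  note CG = stableD(4)[OF C]
  have "attracted g a ?C"
    unfolding attracted_def
  proof (intro conjI allI impI aG)
    fix V assume V: "co_subgroup V"
    have "(\<Union>n. {- int n..}) = UNIV"
    proof (intro equalityI subsetI)
      fix i :: int
      have "i \<in> {- int (nat \<bar>i\<bar>)..}" by auto
      then show "i \<in> (\<Union>n. {- int n..})" by blast
    qed auto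
    moreover have "mono (\<lambda>n. {- int n..})" by (auto simp: mono_def)
    ultimately obtain m :: nat where m: "seg g U {- int m..} \<subseteq> V <#> ?C"
      using compactin_chain_seg[OF U'(2) g, of "\<lambda>n. {- int n..}" "V <#> ?C"]
        subset_co_subgroup_mult[OF V CG] openin_set_mult[OF co_subgroupD(3)[OF V] CG] by auto
    have "ad g (int n) a \<in> V <#> ?C" if "n \<ge> m" for n
    proof -
      have "ad g (int n) a \<in> seg g U {- int m..}"
        using a that unfolding ad_in_seg[OF g aG] by (simp add: seg_def)
      then show ?thesis using m by blast
    qed
    then show "\<forall>\<^sub>F n in sequentially. ad g (int n) a \<in> V <#> ?C"
      unfolding eventually_sequentially by blast
  qed
  then obtain c where c: "c \<in> ?C" "a \<otimes> c \<in> con G T g" using attracted_imp_con[OF g C] by blast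
  have cG: "c \<in> carrier G" using c CG by blast
  have "inv c \<in> ?C" using subgroup.m_inv_closed[OF stableD(1)[OF C] c(1)] .
  then have ic: "inv c \<in> seg g U {0..}" "inv c \<in> seg (inv g) U {0..}"
    using g by (auto simp: seg_def ad_inv_left)
  have "cj (inv c) x \<in> core g"
  proof (rule core_cjI[OF _ subgroup_core _ _ x])
    show "cj (inv c) s \<in> core g" if "s \<in> T closure_of con G T g" for s
      using closure_cj[OF _ seg_normalizes_con[OF U' g ic(1)] that] closure_con_core(1) cG by blast
    show "cj (inv c) s \<in> core g" if "s \<in> T closure_of con G T (inv g)" for s
      using closure_cj[OF _ seg_normalizes_con[OF U' _ ic(2)] that] closure_con_core(2) cG g by blast
  qed (use cG in simp)
  then have "cj (a \<otimes> c) (cj (inv c) x) \<in> core g"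
    using cj_in_subgroup[OF subgroup_core] c(2) con_core by blast
  moreover have "cj (a \<otimes> c) (cj (inv c) x) = cj a x"
    using aG cG xG by (simp add: cj_def group_rewr)
  ultimately show ?thesis by simp
qed

text \<open>Both factors of \<open>u\<close> are covered by \<open>seg_normalizes_core\<close>: the
  second one for \<open>inv g\<close>, which has the same \<open>core\<close>.\<close>

lemma tidy_above_normalizes_core:
  assumes U: "co_subgroup U" and g: "g \<in> carrier G" and t: "tidy_above g U" and u: "u \<in> U" and x: "x \<in> core g"
  shows "cj u x \<in> core g"
proof -
  obtain a b where ab: "a \<in> seg g U {0..}" "b \<in> seg g U {..0}" "u = a \<otimes> b"
    using t u unfolding tidy_above_def by blast
  have "b \<in> seg (inv g) U {0..}" using ab(2) g by (simp add: seg_inv)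
  then have "cj b x \<in> core g"
    using seg_normalizes_core[OF U, of "inv g" b x] g x by (simp add: core_inv)
  then have "cj a (cj b x) \<in> core g" using seg_normalizes_core[OF U g ab(1)] by blast
  moreover have "a \<in> carrier G" "b \<in> carrier G" "x \<in> carrier G" using ab x core_subset by (auto simp: seg_def)
  ultimately show ?thesis using ab(3) by (simp add: cj_cj)
qed

text \<open>Tracking conjugates each contraction group of \<open>u \<otimes> g\<close> and its
  inverse into the matching one for \<open>g\<close>, by an element of \<open>U\<close>, and such
  elements normalize \<open>core g\<close>. The inverse carries its perturbation on the
  right.\<close>

lemma core_perturb_subset:
  assumes U: "co_subgroup U" and g: "g \<in> carrier G" and t: "tidy_above g U" and u: "u \<in> U"
  shows "core (u \<otimes> g) \<subseteq> core g"
proof -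
  note U' = co_subgroupD(1,2)[OF U]
  have uG: "u \<in> carrier G" using u co_subgroup_subset[OF U] by blast
  have undo: "s \<in> core g" if "z \<in> U" "s \<in> carrier G" "cj z s \<in> core g" for s z
  proof -
    have "cj (inv z) (cj z s) \<in> core g"
      using tidy_above_normalizes_core[OF U g t subgroup.m_inv_closed[OF U'(1)]] that by blast
    then show ?thesis using that co_subgroup_subset[OF U] by auto
  qed
  obtain z where z: "z \<in> U" "\<And>n::nat. (u \<otimes> g) [^] int n \<otimes> inv z \<otimes> inv (g [^] int n) \<in> U"
    using tidy_above_track[OF U' g t u] by blast
  obtain y where y: "y \<in> U"
    "\<And>n::nat. (inv g \<otimes> inv u) [^] int n \<otimes> inv y \<otimes> inv (inv g [^] int n) \<in> U"
    using tidy_above_track_right[OF U' _ tidy_above_inv[OF U'(1) g t] subgroup.m_inv_closed[OF U'(1) u]] g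
    by blast
  have G: "z \<in> carrier G" "y \<in> carrier G" using z y co_subgroup_subset[OF U] by auto
  have "T closure_of con G T (u \<otimes> g) \<subseteq> core g"
  proof
    fix s assume s: "s \<in> T closure_of con G T (u \<otimes> g)"
    have "cj z x \<in> con G T g" if "x \<in> con G T (u \<otimes> g)" for x
      using con_track[OF U' g _ z that] uG g by simp
    then have "cj z s \<in> core g" using closure_cj[OF G(1) _ s] closure_con_core(1) by blast
    then show "s \<in> core g" using undo[OF z(1)] s closure_con_subset by blast
  qed
  moreover have "T closure_of con G T (inv (u \<otimes> g)) \<subseteq> core g"
  proof
    fix s assume s: "s \<in> T closure_of con G T (inv (u \<otimes> g))"
    have "cj y x \<in> con G T (inv g)" if "x \<in> con G T (inv (u \<otimes> g))" for x
      using con_track[OF U' _ _ y, of x] that uG g by (simp add: inv_mult_group)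
    then have "cj y s \<in> core g" using closure_cj[OF G(2) _ s] closure_con_core(2) by blast
    then show "s \<in> core g" using undo[OF y(1)] s closure_con_subset by blast
  qed
  ultimately show ?thesis
    unfolding core_def[of "u \<otimes> g"] using generate_subgroup_incl[OF _ subgroup_core] by simp
qed

text \<open>The reverse inclusion perturbs \<open>u \<otimes> g\<close> back by
  \<open>inv u\<close>, which requires the decomposition of \<open>U\<close> for
  \<open>u \<otimes> g\<close> from \<open>tidy_above_perturb\<close>.\<close>

lemma core_perturb:
  assumes U: "co_subgroup U" and g: "g \<in> carrier G" and t: "tidy_above g U" and u: "u \<in> U"
  shows "core (u \<otimes> g) = core g"
proof
  have uG: "u \<in> carrier G" using u co_subgroup_subset[OF U] by blast
  have "core (inv u \<otimes> (u \<otimes> g)) \<subseteq> core (u \<otimes> g)"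
    using core_perturb_subset[OF U _ tidy_above_perturb[OF co_subgroupD(1,2)[OF U] g t u]
        subgroup.m_inv_closed[OF co_subgroupD(1)[OF U] u]] uG g by simp
  then show "core g \<subseteq> core (u \<otimes> g)" using uG g by (simp add: inv_mult_cancel)
qed (rule core_perturb_subset[OF assms])

lemma con_cj:
  assumes x: "x \<in> carrier G" and h: "h \<in> carrier G" and s: "s \<in> con G T h"
  shows "cj x s \<in> con G T (cj x h)"
  unfolding con_iff[OF cj_closed[OF x h]]
proof (intro conjI allI impI)
  have sG: "s \<in> carrier G" using s con_subset by blast
  then show "cj x s \<in> carrier G" using x by simp
  fix V assume V: "co_subgroup V"
  have "\<forall>\<^sub>F n in sequentially. ad h (int n) s \<in> {y \<in> carrier G. cj x y \<in> V}"
    using s co_subgroup_cj_vimage[OF V x] unfolding con_iff[OF h] by blast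
  then show "\<forall>\<^sub>F n in sequentially. ad (cj x h) (int n) (cj x s) \<in> V"
    using x h sG by (simp add: ad_cj)
qed

lemma core_cj:
  assumes x: "x \<in> carrier G" and h: "h \<in> carrier G" and s: "s \<in> core h"
  shows "cj x s \<in> core (cj x h)"
proof (rule core_cjI[OF x subgroup_core _ _ s])
  show "cj x s \<in> core (cj x h)" if "s \<in> T closure_of con G T h" for s
    using closure_cj[OF x con_cj[OF x h] that] closure_con_core(1) by blast
  show "cj x s \<in> core (cj x h)" if "s \<in> T closure_of con G T (inv h)" for s
    using closure_cj[OF x con_cj[OF x inv_closed[OF h]] that] closure_con_core(2) cj_inv[OF x h] by auto
qed

text \<open>The orbit under the power is a subsequence of the orbit under \<open>h\<close>.\<close>

lemma con_pow:
  assumes h: "h \<in> carrier G" and r: "r > 0"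
  shows "con G T h \<subseteq> con G T (h [^] int r)"
proof
  fix s assume s: "s \<in> con G T h"
  show "s \<in> con G T (h [^] int r)"
    unfolding con_iff[OF int_pow_closed[OF h]]
  proof (intro conjI allI impI)
    show "s \<in> carrier G" using s con_subset by blast
    fix V assume "co_subgroup V"
    then have "\<forall>\<^sub>F n in sequentially. ad h (int n) s \<in> V" using s by (simp add: con_iff[OF h])
    then obtain k where k: "\<And>n. n \<ge> k \<Longrightarrow> ad h (int n) s \<in> V" unfolding eventually_sequentially by blast
    have "ad (h [^] int r) (int n) s \<in> V" if "n \<ge> k" for n
    proof -
      have "r * n \<ge> k" using that r by (metis One_nat_def Suc_leI mult_le_mono mult_1)
      from k[OF this] show ?thesis using h by (simp add: ad_def int_pow_pow)
    qed
    then show "\<forall>\<^sub>F n in sequentially. ad (h [^] int r) (int n) s \<in> V"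
      unfolding eventually_sequentially by blast
  qed
qed

section \<open>Cocompact flat subgroups\<close>

text \<open>\<open>V x\<close> is a neighbourhood of \<open>x\<close>. This trades a point of the
  closure for a point of \<open>H\<close> at the cost of a factor from \<open>V\<close>.\<close>

lemma closure_of_translate:
  assumes H: "H \<subseteq> carrier G" and x: "x \<in> T closure_of H" and V: "co_subgroup V"
  shows "\<exists>v\<in>V. v \<otimes> x \<in> H"
proof -
  have xG: "x \<in> carrier G" using x by (simp add: in_closure_of topspace_eq_carrier)
  have "openin T {y \<in> carrier G. y \<otimes> inv x \<in> V}"
    using xG co_subgroupD(3)[OF V] by (intro openin_preimage continuous_group_intros) auto
  moreover have "x \<in> {y \<in> carrier G. y \<otimes> inv x \<in> V}"
    using xG subgroup.one_closed[OF co_subgroupD(1)[OF V]] by simp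
  moreover have "\<forall>S. x \<in> S \<and> openin T S \<longrightarrow> (\<exists>y. y \<in> H \<and> y \<in> S)"
    using x by (simp add: in_closure_of)
  ultimately have "\<exists>y. y \<in> H \<and> y \<in> {y \<in> carrier G. y \<otimes> inv x \<in> V}" by (metis (lifting))
  then obtain y where y: "y \<in> H" "y \<in> carrier G" "y \<otimes> inv x \<in> V" by blast
  then have "(y \<otimes> inv x) \<otimes> x \<in> H" using xG by (simp add: m_assoc)
  then show ?thesis using y by blast
qed

text \<open>\<open>Q x\<close> is the part of \<open>L\<close> inside \<open>x U K\<close>. It is
  relatively open and saturated for the coset map, so its image is open in the coset space, and
  finitely many such images cover.\<close>

lemma cocompact_cover:
  assumes K: "subgroup K G" and L: "L \<subseteq> carrier G" and U: "co_subgroup U"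
    and cpt: "compact_space (coset_space G T L K)"
  shows "\<exists>F. finite F \<and> F \<subseteq> L \<and> (\<forall>l\<in>L. \<exists>x\<in>F. \<exists>u\<in>U. \<exists>k\<in>K. l = x \<otimes> u \<otimes> k)"
proof -
  note KG = subgroup.subset[OF K]
  let ?q = "\<lambda>x. x <# K"
  define Q where "Q x = {l \<in> L. \<exists>k\<in>K. inv x \<otimes> (l \<otimes> k) \<in> U}" for x
  have tL: "topspace (subtopology T L) = L" using L by (auto simp: topspace_eq_carrier)
  have sat: "l \<in> Q x" if l: "l \<in> L" and x: "x \<in> L" and q: "?q l \<in> ?q ` Q x" for l x
  proof -
    obtain m k where m: "m \<in> L" "k \<in> K" "inv x \<otimes> (m \<otimes> k) \<in> U" "l <# K = m <# K"
      using q by (auto simp: Q_def)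
    have "m \<otimes> \<one> \<in> m <# K" using subgroup.one_closed[OF K] by (auto simp: l_coset_def)
    then have "m \<otimes> \<one> \<in> l <# K" using m(4) by simp
    then obtain j where j: "j \<in> K" "m = l \<otimes> j" using m(1) L by (auto simp: l_coset_def)
    have "m \<otimes> k = l \<otimes> (j \<otimes> k)" using j m KG L l by (auto simp: m_assoc subset_iff)
    then show ?thesis using m(2,3) l subgroup.m_closed[OF K j(1) m(2)] by (auto simp: Q_def)
  qed
  have op: "openin (coset_space G T L K) (?q ` Q x)" if x: "x \<in> L" for x
    unfolding coset_space_def openin_quotient_topology
  proof (intro conjI)
    show "?q ` Q x \<subseteq> ?q ` topspace (subtopology T L)" unfolding tL by (auto simp: Q_def)
    have "{l \<in> L. ?q l \<in> ?q ` Q x} = Q x" using sat[OF _ x] by (auto simp: Q_def)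
    also have "\<dots> = L \<inter> (\<Union>k\<in>K. {l \<in> carrier G. inv x \<otimes> (l \<otimes> k) \<in> U})"
      using L by (auto simp: Q_def)
    finally have eq: "{l \<in> topspace (subtopology T L). ?q l \<in> ?q ` Q x}
        = L \<inter> (\<Union>k\<in>K. {l \<in> carrier G. inv x \<otimes> (l \<otimes> k) \<in> U})"
      unfolding tL .
    have "openin T {l \<in> carrier G. inv x \<otimes> (l \<otimes> k) \<in> U}" if "k \<in> K" for k
      using that KG x L by (intro openin_preimage[OF _ co_subgroupD(3)[OF U]] continuous_group_intros) auto
    then have "openin T (\<Union>k\<in>K. {l \<in> carrier G. inv x \<otimes> (l \<otimes> k) \<in> U})" by (intro openin_Union) auto
    then show "openin (subtopology T L) {l \<in> topspace (subtopology T L). ?q l \<in> ?q ` Q x}"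
      unfolding eq by (rule openin_subtopology_Int2)
  qed
  have ts: "topspace (coset_space G T L K) = ?q ` L"
    unfolding coset_space_def topspace_quotient_topology tL ..
  have self: "x \<in> Q x" if "x \<in> L" for x
    using that L subgroup.one_closed[OF K] subgroup.one_closed[OF co_subgroupD(1)[OF U]]
    by (auto simp: Q_def subset_iff intro!: bexI[of _ \<one>])
  have "compactin (coset_space G T L K) (?q ` L)" using cpt ts by (simp add: compact_space_def)
  moreover have "?q ` L \<subseteq> \<Union>((\<lambda>x. ?q ` Q x) ` L)" using self by blast
  moreover have "\<forall>S\<in>(\<lambda>x. ?q ` Q x) ` L. openin (coset_space G T L K) S" using op by blast
  ultimately obtain \<F> where \<F>: "finite \<F>" "\<F> \<subseteq> (\<lambda>x. ?q ` Q x) ` L" "?q ` L \<subseteq> \<Union>\<F>"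
    unfolding compactin_def by meson
  then obtain F where F: "F \<subseteq> L" "finite F" "\<F> = (\<lambda>x. ?q ` Q x) ` F"
    using finite_subset_image by metis
  have "\<exists>x\<in>F. \<exists>u\<in>U. \<exists>k\<in>K. l = x \<otimes> u \<otimes> k" if l: "l \<in> L" for l
  proof -
    have "?q l \<in> \<Union>\<F>" using \<F>(3) l by blast
    then obtain x where x: "x \<in> F" "?q l \<in> ?q ` Q x" unfolding F(3) by blast
    then have "l \<in> Q x" using sat l F(1) by blast
    then obtain k where k: "k \<in> K" "inv x \<otimes> (l \<otimes> k) \<in> U" by (auto simp: Q_def)
    have G: "x \<in> carrier G" "l \<in> carrier G" "k \<in> carrier G" using x k l F(1) L KG by auto
    have "l = x \<otimes> (inv x \<otimes> (l \<otimes> k)) \<otimes> inv k" using G by (simp add: group_rewr)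
    then show ?thesis using x(1) k subgroup.m_inv_closed[OF K k(1)] by blast
  qed
  then show ?thesis using F(1,2) by blast
qed

lemma openin_normalizer:
  assumes M: "M \<subseteq> carrier G" and W: "openin T W" "\<one> \<in> W" "W \<subseteq> normalizer G M"
  shows "openin T (normalizer G M)"
proof -
  have N: "subgroup (normalizer G M) G" using normalizer_imp_subgroup[OF M] .
  note NG = subgroup.subset[OF N]
  have "W <#> normalizer G M = normalizer G M"
  proof (intro equalityI subsetI)
    fix x assume "x \<in> W <#> normalizer G M"
    then show "x \<in> normalizer G M"
      using W(3) subgroup.m_closed[OF N] by (auto simp: set_mult_def)
  next
    fix x assume x: "x \<in> normalizer G M"
    then have "x = \<one> \<otimes> x" using NG by auto
    then show "x \<in> W <#> normalizer G M" using x W(2) unfolding set_mult_def by blast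
  qed
  then show ?thesis using openin_set_mult[OF W(1) NG] by simp
qed

text \<open>Two powers share the same \<open>x\<close> by pigeonhole. Dividing one by the other
  leaves \<open>x (u n) (k n) (k m)^-1 (u m)^-1 x^-1\<close>, regrouped as a conjugate of an element
  of \<open>U K\<close>.\<close>

lemma exists_power_in_coset:
  fixes h :: 'a
  assumes h: "h \<in> carrier G" and F: "finite F" "F \<subseteq> carrier G" and U: "subgroup U G" and K: "subgroup K G"
    and cover: "\<And>n::nat. \<exists>x\<in>F. \<exists>u\<in>U. \<exists>k\<in>K. h [^] int n = x \<otimes> u \<otimes> k"
  shows "\<exists>r>0. \<exists>x\<in>F. \<exists>u\<in>U. \<exists>w\<in>U. \<exists>k\<in>K. h [^] int r = cj x (cj w (u \<otimes> k))"
proof -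
  obtain x u k where xuk: "\<And>n::nat. x n \<in> F" "\<And>n. u n \<in> U" "\<And>n. k n \<in> K"
    "\<And>n. h [^] int n = x n \<otimes> u n \<otimes> k n"
    using cover by metis
  have "range x \<subseteq> F" using xuk(1) by blast
  then have "finite (range x)" using F(1) finite_subset by blast
  then have "\<not> inj x" using finite_imageD[of x UNIV] by auto
  then obtain m n where mn: "m < n" "x m = x n" unfolding inj_def by (metis linorder_neqE_nat)
  have G: "x i \<in> carrier G" "u i \<in> carrier G" "k i \<in> carrier G" for i
    using xuk F(2) subgroup.subset[OF U] subgroup.subset[OF K] by blast+
  have "h [^] int (n - m) = h [^] int n \<otimes> inv (h [^] int m)"
    using mn h int_pow_diff[OF h, of "int n" "int m"] by (simp add: of_nat_diff)
  also have "\<dots> = x n \<otimes> u n \<otimes> k n \<otimes> inv (x n \<otimes> u m \<otimes> k m)"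
    unfolding xuk(4) mn(2) ..
  also have "\<dots> = cj (x n) (cj (u m) (inv (u m) \<otimes> u n \<otimes> (k n \<otimes> inv (k m))))"
    using G by (simp add: cj_def group_rewr)
  finally have "h [^] int (n - m) = cj (x n) (cj (u m) (inv (u m) \<otimes> u n \<otimes> (k n \<otimes> inv (k m))))" .
  moreover have "inv (u m) \<otimes> u n \<in> U" "k n \<otimes> inv (k m) \<in> K"
    using xuk U K by (simp_all add: subgroup.m_closed subgroup.m_inv_closed)
  moreover have "n - m > 0" using mn by simp
  ultimately show ?thesis using xuk(1,2) by blast
qed

lemma normalizer_relative_Tits_core_open:
  assumes H: "almost_flat G T H"
  shows "openin T (normalizer G (relative_Tits_core G T H))"
proof -
  let ?L = "T closure_of H"
  obtain K where sH: "subgroup H G" and KL: "K \<subseteq> ?L"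
    and cpt: "compact_space (coset_space G T ?L K)" and flat: "flat_subgroup G T K"
    using H by (auto simp: almost_flat_def)
  obtain U where K: "subgroup K G" and U: "co_subgroup U" and tU: "\<And>k. k \<in> K \<Longrightarrow> tidy G T (inner_aut G k) U"
    using flat by (auto simp: flat_subgroup_def)
  note HG = subgroup.subset[OF sH] and KG = subgroup.subset[OF K] and UG = co_subgroup_subset[OF U]
  have LG: "?L \<subseteq> carrier G" using closure_of_subset_topspace[of T H] topspace_eq_carrier by simp
  have HL: "H \<subseteq> ?L" using HG closure_of_subset topspace_eq_carrier by metis
  have t: "tidy_above k U" if "k \<in> K" for k
    using tidy_imp_tidy_above[OF _ tU[OF that]] that KG by blast
  obtain F where "finite F \<and> F \<subseteq> ?L \<and> (\<forall>l\<in>?L. \<exists>x\<in>F. \<exists>u\<in>U. \<exists>k\<in>K. l = x \<otimes> u \<otimes> k)"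
    using cocompact_cover[OF K LG U cpt] by (rule exE)
  then have F: "finite F" "F \<subseteq> ?L"
    and cover: "\<And>l. l \<in> ?L \<Longrightarrow> \<exists>x\<in>F. \<exists>u\<in>U. \<exists>k\<in>K. l = x \<otimes> u \<otimes> k"
    by simp_all
  have FG: "F \<subseteq> carrier G" using F(2) LG by blast
  \<comment> \<open>\<open>Ux x\<close> is \<open>x U x^-1\<close>, which inherits the decomposition
    for \<open>cj x k\<close>.\<close>
  define Ux where "Ux x = {y \<in> carrier G. cj (inv x) y \<in> U}" for x
  have Ux: "co_subgroup (Ux x)" if "x \<in> F" for x
    unfolding Ux_def using that FG by (intro co_subgroup_cj_vimage[OF U]) auto
  have tUx: "tidy_above (cj x k) (Ux x)" if "x \<in> F" "k \<in> K" for x k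
    unfolding Ux_def using that FG KG by (intro tidy_above_cj[OF _ _ UG t]) auto
  define S where "S = (\<Union>x\<in>F. \<Union>k\<in>K. core (cj x k))"
  have SG: "S \<subseteq> carrier G" using core_subset unfolding S_def by blast
  let ?M = "generate G S" and ?D = "relative_Tits_core G T H"
  have M: "subgroup ?M G" by (rule generate_is_subgroup[OF SG])
  have DG: "(\<Union>h\<in>H. T closure_of (con G T h)) \<subseteq> carrier G" using closure_con_subset by blast
  have D: "subgroup ?D G" unfolding relative_Tits_core_def by (rule generate_is_subgroup[OF DG])
  \<comment> \<open>Passing to a positive power only enlarges the contraction group of
    \<open>h\<close>, and a suitable power is conjugate to some
    \<open>u \<otimes> k\<close>.\<close>
  have DM: "?D \<subseteq> ?M"
    unfolding relative_Tits_core_def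
  proof (rule generate_subgroup_incl[OF _ M], rule UN_least)
    fix h assume h: "h \<in> H"
    have hG: "h \<in> carrier G" using h HG by blast
    have "h [^] int n \<in> ?L" for n :: nat using HL subgroup_int_pow_closed[OF sH h] by blast
    then have "\<exists>x\<in>F. \<exists>u\<in>U. \<exists>k\<in>K. h [^] int n = x \<otimes> u \<otimes> k" for n :: nat
      by (rule cover)
    from exists_power_in_coset[OF hG F(1) FG co_subgroupD(1)[OF U] K this] obtain r x u w k where r: "r > 0" "x \<in> F" "u \<in> U" "w \<in> U" "k \<in> K"
        and eq: "h [^] int r = cj x (cj w (u \<otimes> k))"
      by blast
    have G: "x \<in> carrier G" "u \<in> carrier G" "w \<in> carrier G" "k \<in> carrier G"
      using r FG UG KG by auto
    have "T closure_of con G T h \<subseteq> T closure_of con G T (h [^] int r)"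
      by (intro closure_of_mono con_pow hG r)
    also have "\<dots> \<subseteq> core (cj x k)"
    proof
      fix s assume "s \<in> T closure_of con G T (h [^] int r)"
      then have s: "s \<in> core (cj (x \<otimes> w) (u \<otimes> k))"
        unfolding eq using closure_con_core(1) G by (auto simp: cj_cj)
      have sG: "s \<in> carrier G" using s core_subset by blast
      \<comment> \<open>Undoing the conjugation leads to \<open>u \<otimes> k\<close>, whose
        \<open>core\<close> is that of \<open>k\<close>. Then \<open>w\<close> is absorbed because
        \<open>U\<close> normalizes \<open>core k\<close>, and \<open>x\<close> leads to
        \<open>cj x k\<close>.\<close>
      have "cj (inv (x \<otimes> w)) s \<in> core (cj (inv (x \<otimes> w)) (cj (x \<otimes> w) (u \<otimes> k)))"
        by (rule core_cj[OF _ _ s]) (use G in auto)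
      then have "cj (inv (x \<otimes> w)) s \<in> core k"
        using core_perturb[OF U G(4) t[OF r(5)] r(3)] G by simp
      then have "cj w (cj (inv (x \<otimes> w)) s) \<in> core k"
        using tidy_above_normalizes_core[OF U G(4) t[OF r(5)] r(4)] by blast
      then have "cj x (cj w (cj (inv (x \<otimes> w)) s)) \<in> core (cj x k)"
        using core_cj[OF G(1,4)] by blast
      moreover have "cj x (cj w (cj (inv (x \<otimes> w)) s)) = s"
        using G sG by (simp add: cj_def group_rewr)
      ultimately show "s \<in> core (cj x k)" by simp
    qed
    also have "\<dots> \<subseteq> ?M" using r(2,5) unfolding S_def by (auto intro: generate.incl)
    finally show "T closure_of con G T h \<subseteq> ?M" .
  qed
  \<comment> \<open>\<open>x\<close> and \<open>k\<close> are only known to lie in the closure of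
    \<open>H\<close>. Moving both into \<open>H\<close> changes \<open>cj x k\<close> by a left
    factor from \<open>Ux x\<close>, which leaves \<open>core\<close> unchanged.\<close>
  have SD: "core (cj x k) \<subseteq> ?D" if x: "x \<in> F" and k: "k \<in> K" for x k
  proof -
    let ?g = "cj x k"
    have G: "x \<in> carrier G" "k \<in> carrier G" using x k FG KG by auto
    have gG: "?g \<in> carrier G" using G by simp
    note Ux = Ux[OF x]
    \<comment> \<open>The second condition on \<open>v\<close> is there because \<open>v\<close>
      enters \<open>?u\<close> again through \<open>cj ?g v\<close>.\<close>
    obtain v where v: "v \<in> Ux x \<inter> {y \<in> carrier G. cj ?g y \<in> Ux x}" "v \<otimes> x \<in> H"
      using closure_of_translate[OF HG _ co_subgroup_Int[OF Ux co_subgroup_cj_vimage[OF Ux gG]], of x] x F(2) by blast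
    obtain w where w: "w \<in> U" "w \<otimes> k \<in> H"
      using closure_of_translate[OF HG _ U, of k] k KL by blast
    have vwG: "v \<in> carrier G" "w \<in> carrier G" using v w UG by auto
    let ?u = "v \<otimes> cj x w \<otimes> inv (cj ?g v)"
    have "cj x w \<in> Ux x" using w vwG G by (simp add: Ux_def)
    then have uU: "?u \<in> Ux x"
      using v co_subgroupD(1)[OF Ux] by (simp add: subgroup.m_closed subgroup.m_inv_closed)
    have "cj (v \<otimes> x) (w \<otimes> k) \<in> H" using cj_in_subgroup[OF sH v(2) w(2)] .
    moreover have "cj (v \<otimes> x) (w \<otimes> k) = ?u \<otimes> ?g" using G vwG by (simp add: cj_def group_rewr)
    ultimately have ug: "?u \<otimes> ?g \<in> H" by simp
    have "core ?g = core (?u \<otimes> ?g)"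
      using core_perturb[OF Ux gG tUx[OF x k] uU] by simp
    also have "\<dots> \<subseteq> ?D"
      unfolding core_def
    proof (rule generate_subgroup_incl[OF _ D])
      have "T closure_of con G T h \<subseteq> ?D" if "h \<in> H" for h
        unfolding relative_Tits_core_def using that by (auto intro: generate.incl)
      then show "T closure_of con G T (?u \<otimes> ?g) \<union> T closure_of con G T (inv (?u \<otimes> ?g)) \<subseteq> ?D"
        using ug subgroup.m_inv_closed[OF sH ug] by blast
    qed
    finally show ?thesis .
  qed
  have "?M \<subseteq> ?D" by (rule generate_subgroup_incl[OF _ D]) (use SD in \<open>auto simp: S_def\<close>)
  then have eq: "?D = ?M" using DM by blast
  \<comment> \<open>A finite intersection of open groups, each normalizing its own family of
    generators. The factor \<open>carrier G\<close> gives the right value for empty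
    \<open>F\<close>.\<close>
  define W where "W = carrier G \<inter> (\<Inter>x\<in>F. Ux x)"
  have "openin T W"
  proof (cases "F = {}")
    case False
    then have "openin T (\<Inter>x\<in>F. Ux x)" using F(1) Ux co_subgroupD(3) by (intro openin_Inter) auto
    then show ?thesis unfolding W_def using openin_carrier by blast
  qed (simp add: W_def openin_carrier)
  moreover have "\<one> \<in> W" unfolding W_def using subgroup.one_closed[OF co_subgroupD(1)[OF Ux]] by blast
  moreover have "W \<subseteq> normalizer G ?M"
  proof
    fix w assume w: "w \<in> W"
    have norm: "cj v y \<in> ?M" if v: "v \<in> carrier G" "\<And>x. x \<in> F \<Longrightarrow> v \<in> Ux x" and y: "y \<in> ?M" for v y
    proof (rule generate_cj[OF v(1) SG M _ y])
      fix s assume "s \<in> S"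
      then obtain x k where xk: "x \<in> F" "k \<in> K" "s \<in> core (cj x k)" unfolding S_def by blast
      have "cj x k \<in> carrier G" using xk FG KG by blast
      then have "cj v s \<in> core (cj x k)"
        using tidy_above_normalizes_core[OF Ux[OF xk(1)] _ tUx[OF xk(1,2)] v(2)[OF xk(1)] xk(3)] by blast
      then show "cj v s \<in> ?M" using xk unfolding S_def by (blast intro: generate.incl)
    qed
    have wU: "w \<in> Ux x" if "x \<in> F" for x using w that by (auto simp: W_def)
    have wG: "w \<in> carrier G" using w by (simp add: W_def)
    have iwU: "inv w \<in> Ux x" if "x \<in> F" for x
      using subgroup.m_inv_closed[OF co_subgroupD(1)[OF Ux[OF that]] wU[OF that]] .
    show "w \<in> normalizer G ?M"
      using norm[OF wG wU] norm[OF inv_closed[OF wG] iwU]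
      by (intro mem_normalizerI subgroup.subset[OF M] wG) auto
  qed
  ultimately show ?thesis unfolding eq by (rule openin_normalizer[OF subgroup.subset[OF M]])
qed

end

theorem corollary1p3:
  fixes G :: "('a, 'b) monoid_scheme" and T :: "'a topology" and H :: "'a set"
  assumes "tdlc_group G T"
    and "almost_flat G T H"
  shows "openin T (normalizer G (relative_Tits_core G T H))"
  using tdlc_group.normalizer_relative_Tits_core_open[OF assms] .

end
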